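(* Every $(3,2)$-saturated subcubic graph $G$ such that $g_3(G)=3$ is $(1,1,3,3,3)$-packing colorable.
   Context: All graphs are finite, simple and undirected. For a non-decreasing sequence $S=(s_1,\dots,s_k)$ of positive integers, an $S$-packing coloring of $G$ is a partition of $V(G)$ into sets $V_1,\dots,V_k$ such that any two distinct vertices $u,v\in V_i$ satisfy $dist_G(u,v)>s_i$; $G$ is $S$-packing colorable if it admits one. $G$ is subcubic if its maximum degree is at most $3$. In a subcubic graph, a vertex of degree $3$ is heavy if all its neighbors have degree $3$. A subcubic graph is $(3,k)$-saturated ($0\le k\le 3$) if each heavy vertex is adjacent to at most $k$ heavy vertices. The local girth $g(v)$ of a vertex $v$ is the length of a shortest cycle containing $v$ ($\infty$ if none), and $g_3(G)=\max\{g(v): d_G(v)=3\}$. *)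

theory Defs
  imports Main "HOL-Library.Extended_Nat" "HOL-Library.Disjoint_Sets"
begin

definition simple_graph :: "'a set \<Rightarrow> 'a set set \<Rightarrow> bool" where
  "simple_graph V E \<longleftrightarrow> finite V \<and> (\<forall>e\<in>E. e \<subseteq> V \<and> card e = 2)"

definition nbrs :: "'a set set \<Rightarrow> 'a \<Rightarrow> 'a set" where
  "nbrs E v = {u. {v, u} \<in> E}"

definition vdegree :: "'a set set \<Rightarrow> 'a \<Rightarrow> nat" where
  "vdegree E v = card (nbrs E v)"

definition subcubic :: "'a set \<Rightarrow> 'a set set \<Rightarrow> bool" where
  "subcubic V E \<longleftrightarrow> (\<forall>v\<in>V. vdegree E v \<le> 3)"

definition heavy :: "'a set set \<Rightarrow> 'a \<Rightarrow> bool" where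
  "heavy E v \<longleftrightarrow> vdegree E v = 3 \<and> (\<forall>u\<in>nbrs E v. vdegree E u = 3)"

definition saturated3 :: "'a set \<Rightarrow> 'a set set \<Rightarrow> nat \<Rightarrow> bool" where
  "saturated3 V E k \<longleftrightarrow> (\<forall>v\<in>V. heavy E v \<longrightarrow> card {u \<in> nbrs E v. heavy E u} \<le> k)"

definition walk_in :: "'a set \<Rightarrow> 'a set set \<Rightarrow> 'a list \<Rightarrow> bool" where
  "walk_in V E p \<longleftrightarrow> p \<noteq> [] \<and> set p \<subseteq> V \<and> successively (\<lambda>x y. {x, y} \<in> E) p"

text \<open>The infimum over the empty set is \<open>\<infinity>\<close>, so vertices in different components are at
  infinite distance.\<close>

definition gdist :: "'a set \<Rightarrow> 'a set set \<Rightarrow> 'a \<Rightarrow> 'a \<Rightarrow> enat" where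
  "gdist V E u v = (INF p \<in> {p. walk_in V E p \<and> hd p = u \<and> last p = v}. enat (length p - 1))"

text \<open>A cycle is given by the list of its vertices, the first one not being repeated at the end;
  its length is thus the length of the list.\<close>

definition cycle_in :: "'a set \<Rightarrow> 'a set set \<Rightarrow> 'a list \<Rightarrow> bool" where
  "cycle_in V E c \<longleftrightarrow> walk_in V E c \<and> distinct c \<and> 3 \<le> length c \<and> {last c, hd c} \<in> E"

definition local_girth :: "'a set \<Rightarrow> 'a set set \<Rightarrow> 'a \<Rightarrow> enat" where
  "local_girth V E v = (INF c \<in> {c. cycle_in V E c \<and> v \<in> set c}. enat (length c))"

text \<open>For finite \<open>V\<close> the supremum is a maximum, except that it is \<open>0\<close> (rather than
  undefined) if there is no vertex of degree 3.\<close>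

definition girth3 :: "'a set \<Rightarrow> 'a set set \<Rightarrow> enat" where
  "girth3 V E = (SUP v \<in> {v \<in> V. vdegree E v = 3}. local_girth V E v)"

text \<open>The classes \<open>P 0, \<dots>, P (k - 1)\<close> may be empty, as usual for colorings.\<close>

definition packing_coloring :: "'a set \<Rightarrow> 'a set set \<Rightarrow> nat list \<Rightarrow> (nat \<Rightarrow> 'a set) \<Rightarrow> bool" where
  "packing_coloring V E S P \<longleftrightarrow>
     (\<Union>i<length S. P i) = V \<and> disjoint_family_on P {..<length S} \<and>
     (\<forall>i<length S. \<forall>u\<in>P i. \<forall>v\<in>P i. u \<noteq> v \<longrightarrow> gdist V E u v > enat (S ! i))"

definition packing_colorable :: "'a set \<Rightarrow> 'a set set \<Rightarrow> nat list \<Rightarrow> bool" where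
  "packing_colorable V E S \<longleftrightarrow> (\<exists>P. packing_coloring V E S P)"

end

theory Submission
  imports Defs
begin

text \<open>Every vertex of degree 3 lies on a triangle. Choose an independent set \<open>T\<close> of triangle vertices
  that meets every triangle, preferring centres of diamonds and vertices with no edge leaving the
  triangle; saturation is what makes independence possible. Among all such sets take one with as few
  pairs at distance at most 3 as possible, and then with as few vertices as possible whose neighbour
  outside the triangle has degree 3. Exchanging one or two elements of \<open>T\<close> inside their triangles
  shows that the conflict graph (distance at most 3) on \<open>T\<close> is 2-degenerate, so \<open>T\<close> splits into
  three classes. The graph without \<open>T\<close> has maximum degree 2. Its components without a vertex of degree 2
  in the whole graph and without a diamond centre, if they are cycles, alternate between triangle
  edges and other edges and are therefore even. From every other cycle one vertex with at most two
  conflicts in \<open>T\<close> can be removed and given one of the three colours of \<open>T\<close>; vertices removed from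
  different cycles are more than 3 apart. What remains is bipartite.\<close>

section \<open>Colouring degenerate relations and unions of matchings\<close>

text \<open>If all three vertices of a triangle have an outgoing edge, its element of
  \<open>T\<close> sees the rest of \<open>T\<close> through three exits only. The exit of another
  vertex of the triangle yields at most one conflict; its own exit yields at most one if the element
  is soft, but up to two if it is hard. Plain counting thus gives 3 or 4, never the desired 2, and
  extremality must supply the rest. Minimising hard elements settles a hard one with a soft vertex
  in its triangle. For an entirely hard triangle saturation is used once more: it forces the
  elements of \<open>T\<close> across the exits to be inner, and inner elements have at most two
  conflicts anyway. A set with conflict degrees at least 3 would then consist of soft elements with
  exactly three conflicts each. Single exchanges show that each of them faces another one across a
  vertex of degree 2, and exchanging both members of such a pair lowers the number of conflicts. For
  a removed vertex the bound 2 comes from its cycle, whose vertices have at most one neighbour in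
  \<open>T\<close>.\<close>

lemma degenerate_colorable:
  fixes R :: "'a \<Rightarrow> 'a \<Rightarrow> bool"
  assumes "finite A" and sym: "\<And>x y. R x y \<Longrightarrow> R y x"
    and deg: "\<And>S. S \<subseteq> A \<Longrightarrow> S \<noteq> {} \<Longrightarrow> \<exists>s\<in>S. card {x \<in> S. x \<noteq> s \<and> R s x} \<le> k"
  shows "\<exists>c::'a \<Rightarrow> nat. \<forall>x\<in>A. c x \<le> k \<and> (\<forall>y\<in>A. x \<noteq> y \<longrightarrow> R x y \<longrightarrow> c x \<noteq> c y)"
  using assms(1) deg
proof (induction A rule: finite_psubset_induct)
  case (psubset A)
  show ?case
  proof (cases "A = {}")
    case False
    then obtain s where s: "s \<in> A" "card {x \<in> A. x \<noteq> s \<and> R s x} \<le> k"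
      using psubset.prems[of A] by auto
    \<comment> \<open>Greedy colouring: \<open>s\<close> is coloured last, when its at most
      \<open>k\<close> related elements leave one of the \<open>k + 1\<close> colours free. The
      hypothesis speaks of all subsets, so \<open>A - {s}\<close> inherits it.\<close>
    have "A - {s} \<subset> A" using s(1) by auto
    then obtain c :: "'a \<Rightarrow> nat" where
      c: "\<forall>x\<in>A - {s}. c x \<le> k \<and> (\<forall>y\<in>A - {s}. x \<noteq> y \<longrightarrow> R x y \<longrightarrow> c x \<noteq> c y)"
      using psubset.IH[of "A - {s}"] psubset.prems by blast
    let ?B = "{x \<in> A. x \<noteq> s \<and> R s x}"
    have "card (c ` ?B) \<le> k"
      using s(2) card_image_le[of ?B c] psubset.hyps by simp
    then have "\<not> {..k} \<subseteq> c ` ?B"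
      using card_mono[of "c ` ?B" "{..k}"] psubset.hyps by auto
    then obtain i where i: "i \<le> k" "i \<notin> c ` ?B" by auto
    have "\<forall>x\<in>A. (c(s := i)) x \<le> k \<and>
        (\<forall>y\<in>A. x \<noteq> y \<longrightarrow> R x y \<longrightarrow> (c(s := i)) x \<noteq> (c(s := i)) y)"
      using c i sym by auto
    then show ?thesis by blast
  qed auto
qed

text \<open>Deleting an edge \<open>{v, m v}\<close> of the first matching and joining the two partners \<open>p v\<close> and
  \<open>p (m v)\<close> keeps the parity of every cycle.\<close>

lemma two_matchings_bipartite:
  fixes m p :: "'a \<Rightarrow> 'a"
  assumes "finite A"
    and "\<And>v. v \<in> A \<Longrightarrow> m v \<in> A \<and> m v \<noteq> v \<and> m (m v) = v"
    and "\<And>v. v \<in> A \<Longrightarrow> p v \<in> A \<and> p v \<noteq> v \<and> p (p v) = v"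
  shows "\<exists>f::'a \<Rightarrow> bool. \<forall>v\<in>A. f (m v) \<noteq> f v \<and> f (p v) \<noteq> f v"
  using assms
proof (induction A arbitrary: p rule: finite_psubset_induct)
  case (psubset A)
  show ?case
  proof (cases "A = {}")
    case False
    then obtain v where v: "v \<in> A" by auto
    define w where "w = m v"
    define B where "B = A - {v, w}"
    have m: "m x \<in> A" "m x \<noteq> x" "m (m x) = x" if "x \<in> A" for x
      using psubset.prems(1) that by auto
    have p: "p x \<in> A" "p x \<noteq> x" "p (p x) = x" if "x \<in> A" for x
      using psubset.prems(2) that by auto
    have w: "w \<in> A" "w \<noteq> v" "m w = v" using m[OF v] by (auto simp: w_def)
    have BA: "B \<subset> A" using v by (auto simp: B_def)
    have mB: "m x \<in> B \<and> m x \<noteq> x \<and> m (m x) = x" if "x \<in> B" for x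
      using that m[of x] w by (auto simp: B_def w_def)
    show ?thesis
    proof (cases "p v = w")
      case True
      \<comment> \<open>The two edges at \<open>v\<close> coincide, so \<open>{v, w}\<close> is a
        component of its own.\<close>
      have pB: "p x \<in> B \<and> p x \<noteq> x \<and> p (p x) = x" if "x \<in> B" for x
        using that p[of x] p[OF v] True by (auto simp: B_def)
      obtain f :: "'a \<Rightarrow> bool" where f: "\<forall>x\<in>B. f (m x) \<noteq> f x \<and> f (p x) \<noteq> f x"
        using psubset.IH[OF BA, of p] mB pB by blast
      have "\<forall>x\<in>A. (f(v := True, w := False)) (m x) \<noteq> (f(v := True, w := False)) x \<and>
          (f(v := True, w := False)) (p x) \<noteq> (f(v := True, w := False)) x"
      proof
        fix x assume "x \<in> A"
        then consider "x = v" | "x = w" | "x \<in> B" by (auto simp: B_def)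
        then show "(f(v := True, w := False)) (m x) \<noteq> (f(v := True, w := False)) x \<and>
          (f(v := True, w := False)) (p x) \<noteq> (f(v := True, w := False)) x"
        proof cases
          case 3
          then show ?thesis using mB[OF 3] pB[OF 3] f by (auto simp: B_def)
        qed (use w w_def True p[OF v] in auto)
      qed
      then show ?thesis by blast
    next
      case False
      define a b where "a = p v" and "b = p w"
      have ab: "a \<in> B" "b \<in> B" "a \<noteq> b" "p a = v" "p b = w"
        using False p[OF v] p[OF w(1)] w(2) by (auto simp: a_def b_def B_def)
      define q where "q = p(a := b, b := a)"
      have qB: "q x \<in> B \<and> q x \<noteq> x \<and> q (q x) = x" if "x \<in> B" for x
        using that p[of x] ab unfolding q_def B_def by (auto simp: a_def b_def)
      obtain f :: "'a \<Rightarrow> bool" where f: "\<forall>x\<in>B. f (m x) \<noteq> f x \<and> f (q x) \<noteq> f x"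
        using psubset.IH[OF BA, of q] mB qB by blast
      define g where "g = f(v := \<not> f a, w := \<not> f b)"
      have f': "f (m x) \<noteq> f x" "f (q x) \<noteq> f x" if "x \<in> B" for x using f that by blast+
      have "q a = b" using ab(3) by (simp add: q_def)
      then have fab: "f a \<noteq> f b" using f'(2)[OF ab(1)] by simp
      have gB: "g x = f x" if "x \<in> B" for x using that by (auto simp: g_def B_def)
      have gv: "g v = (\<not> f a)" "g w = (\<not> f b)" using w by (auto simp: g_def)
      have "\<forall>x\<in>A. g (m x) \<noteq> g x \<and> g (p x) \<noteq> g x"
      proof
        fix x assume "x \<in> A"
        then consider "x = v" | "x = w" | "x = a" | "x = b" | "x \<in> B" "x \<noteq> a" "x \<noteq> b"
          by (auto simp: B_def)
        then show "g (m x) \<noteq> g x \<and> g (p x) \<noteq> g x"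
        proof cases
          case 1
          then have "m x = w" "p x = a" by (simp_all add: w_def a_def)
          then show ?thesis using 1 gv gB ab fab by simp
        next
          case 2
          then have "m x = v" "p x = b" using w by (simp_all add: b_def)
          then show ?thesis using 2 gv gB ab fab by simp
        next
          case 3
          then show ?thesis using gv gB ab mB[OF ab(1)] f'(1)[OF ab(1)] by simp
        next
          case 4
          then show ?thesis using gv gB ab mB[OF ab(2)] f'(1)[OF ab(2)] by simp
        next
          case 5
          have "q x = p x" using 5 by (simp add: q_def)
          then show ?thesis using 5 mB[of x] qB[of x] f'[of x] gB by simp
        qed
      qed
      then show ?thesis by blast
    qed
  qed auto
qed

section \<open>Triangles and diamonds\<close>

locale triangle_subcubic =
  fixes V :: "'a set" and E :: "'a set set"
  assumes simple: "simple_graph V E"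
    and sub: "subcubic V E"
    and sat: "saturated3 V E 2"
    and tri3: "\<And>v. v \<in> V \<Longrightarrow> vdegree E v = 3 \<Longrightarrow>
      \<exists>x y. {v, x} \<in> E \<and> {x, y} \<in> E \<and> {v, y} \<in> E"
begin

definition adj :: "'a \<Rightarrow> 'a \<Rightarrow> bool" where
  "adj x y \<longleftrightarrow> {x, y} \<in> E"

definition tri :: "'a \<Rightarrow> 'a \<Rightarrow> 'a \<Rightarrow> bool" where
  "tri x y z \<longleftrightarrow> adj x y \<and> adj y z \<and> adj x z"

text \<open>For a triangle vertex this is its only possible edge to the outside. Speaking of common
  neighbours avoids naming the triangle, which is ambiguous in a diamond.\<close>

definition out :: "'a \<Rightarrow> 'a \<Rightarrow> bool" where
  "out x z \<longleftrightarrow> adj x z \<and> (\<forall>w. \<not> (adj x w \<and> adj z w))"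

definition center :: "'a \<Rightarrow> bool" where
  "center v \<longleftrightarrow> (\<exists>x y z. tri v x y \<and> tri v x z \<and> y \<noteq> z)"

text \<open>These are the centres of diamonds and the triangle vertices of degree 2.\<close>

definition inner :: "'a \<Rightarrow> bool" where
  "inner v \<longleftrightarrow> (\<exists>x y. tri v x y) \<and> (\<forall>z. \<not> out v z)"

text \<open>Here \<open>z\<close> has degree at most 2. The edge from \<open>v\<close> uses up one
  of its two places, so \<open>z\<close> is on no triangle and can never belong to the
  transversal.\<close>

definition soft :: "'a \<Rightarrow> bool" where
  "soft v \<longleftrightarrow> (\<exists>z. out v z \<and> vdegree E z \<noteq> 3)"

definition hard :: "'a \<Rightarrow> bool" where
  "hard v \<longleftrightarrow> (\<exists>z. out v z \<and> vdegree E z = 3)"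

text \<open>Intermediate vertices may repeat, so this is distance at most 3.\<close>

definition near :: "'a \<Rightarrow> 'a \<Rightarrow> bool" where
  "near u v \<longleftrightarrow> u = v \<or> adj u v \<or> (\<exists>a. adj u a \<and> adj a v) \<or> (\<exists>a b. adj u a \<and> adj a b \<and> adj b v)"

lemma adj_sym: "adj x y \<Longrightarrow> adj y x"
  by (simp add: adj_def insert_commute)

lemma adj_V: "adj x y \<Longrightarrow> x \<in> V" "adj x y \<Longrightarrow> y \<in> V"
  using simple by (auto simp: adj_def simple_graph_def)

lemma adj_irrefl [simp]: "\<not> adj x x"
  using simple by (auto simp: adj_def simple_graph_def)

lemma finite_V: "finite V"
  using simple by (simp add: simple_graph_def)

lemma nbrs_adj: "nbrs E v = {u. adj v u}"
  by (simp add: nbrs_def adj_def)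

lemma finite_nbrs: "finite {u. adj v u}"
  by (rule finite_subset[OF _ finite_V]) (auto dest: adj_V)

lemma vdegree_le: "card {u. adj v u} \<le> 3"
proof (cases "v \<in> V")
  case True
  then show ?thesis using sub by (auto simp: subcubic_def vdegree_def nbrs_adj)
next
  case False
  then have "{u. adj v u} = {}" by (auto dest: adj_V)
  then show ?thesis by simp
qed

lemma nbr_cases:
  assumes "adj v a" "adj v b" "adj v c" "a \<noteq> b" "a \<noteq> c" "b \<noteq> c" "adj v d"
  shows "d = a \<or> d = b \<or> d = c"
proof (rule ccontr)
  assume "\<not> ?thesis"
  then have "card {a, b, c, d} = 4" using assms by auto
  moreover have "card {a, b, c, d} \<le> card {u. adj v u}"
    using assms by (intro card_mono finite_nbrs) auto
  ultimately show False using vdegree_le[of v] by linarith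
qed

lemma degree3I:
  assumes "adj v a" "adj v b" "adj v c" "a \<noteq> b" "a \<noteq> c" "b \<noteq> c"
  shows "vdegree E v = 3"
proof -
  have "card {a, b, c} \<le> card {u. adj v u}"
    using assms by (intro card_mono finite_nbrs) auto
  then show ?thesis using assms vdegree_le[of v] by (auto simp: vdegree_def nbrs_adj)
qed

lemma degree3E:
  assumes "vdegree E v = 3"
  obtains a b c where "adj v a" "adj v b" "adj v c" "a \<noteq> b" "a \<noteq> c" "b \<noteq> c"
proof -
  obtain a b c where "{u. adj v u} = {a, b, c}" "a \<noteq> b" "a \<noteq> c" "b \<noteq> c"
    using assms by (auto simp: vdegree_def nbrs_adj card_3_iff)
  then show ?thesis using that[of a b c] by auto
qed

lemma degree3_tri: "vdegree E v = 3 \<Longrightarrow> \<exists>x y. tri v x y"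
  by (metis adj_V(1) adj_def degree3E tri3 tri_def)

lemma tri_sym: "tri x y z \<Longrightarrow> tri y x z" "tri x y z \<Longrightarrow> tri x z y" "tri x y z \<Longrightarrow> tri z y x"
    "tri x y z \<Longrightarrow> tri y z x" "tri x y z \<Longrightarrow> tri z x y"
  by (auto simp: tri_def intro: adj_sym)

lemma tri_adj:
  assumes "tri x y z"
  shows "adj x y" "adj y x" "adj y z" "adj z y" "adj x z" "adj z x" "x \<noteq> y" "y \<noteq> z" "x \<noteq> z"
  using assms adj_irrefl by (auto simp: tri_def intro: adj_sym)

lemma out_sym: "out x y \<Longrightarrow> out y x"
  by (auto simp: out_def intro: adj_sym)

lemma out_adj: "out x y \<Longrightarrow> adj x y" "out x y \<Longrightarrow> adj y x"
  by (auto simp: out_def intro: adj_sym)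

lemma out_not_tri: "out x z \<Longrightarrow> tri x a b \<Longrightarrow> z \<noteq> a \<and> z \<noteq> b"
  by (metis adj_sym out_def tri_def)

lemma near_sym: "near x y \<Longrightarrow> near y x"
  unfolding near_def by (meson adj_sym)

text \<open>Saturation enters through this form only: to exclude K4, for the independence of the
  transversal, and at triangles with three hard vertices.\<close>

lemma heavy_neighbours:
  assumes "adj v a" "adj v b" "adj v c" "a \<noteq> b" "a \<noteq> c" "b \<noteq> c"
    and "heavy E v" "heavy E a" "heavy E b"
  shows "\<not> heavy E c"
proof
  assume "heavy E c"
  have "card {a, b, c} \<le> card {u \<in> nbrs E v. heavy E u}"
    using assms \<open>heavy E c\<close> finite_nbrs[of v] by (intro card_mono) (auto simp: nbrs_adj)
  moreover have "card {u \<in> nbrs E v. heavy E u} \<le> 2"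
    using sat assms adj_V(1) by (auto simp: saturated3_def)
  ultimately show False using assms by auto
qed

lemma heavyI:
  assumes "adj v a" "adj v b" "adj v c" "a \<noteq> b" "a \<noteq> c" "b \<noteq> c"
    and "vdegree E a = 3" "vdegree E b = 3" "vdegree E c = 3"
  shows "heavy E v"
  unfolding heavy_def nbrs_adj using assms degree3I[of v a b c] nbr_cases[of v a b c] by blast

text \<open>In a K4 all four vertices would be heavy, so each would have three heavy neighbours. Its
  exclusion makes the two centres of a diamond well determined.\<close>

lemma no_K4:
  assumes "tri a b c" "tri a b d" "c \<noteq> d"
  shows "\<not> adj c d"
proof
  assume cd: "adj c d"
  note A = tri_adj[OF assms(1)] tri_adj[OF assms(2)] cd adj_sym[OF cd] assms(3)
  have D: "vdegree E a = 3" "vdegree E b = 3" "vdegree E c = 3" "vdegree E d = 3"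
    using A by (auto intro: degree3I[of a b c d] degree3I[of b a c d] degree3I[of c a b d] degree3I[of d a b c])
  have "heavy E a" using A D by (intro heavyI[of a b c d]) auto
  moreover have "heavy E b" using A D by (intro heavyI[of b a c d]) auto
  moreover have "heavy E c" using A D by (intro heavyI[of c a b d]) auto
  moreover have "heavy E d" using A D by (intro heavyI[of d a b c]) auto
  ultimately show False using heavy_neighbours[of a b c d] A by blast
qed

lemma center_diamond:
  assumes "tri v x y" "tri v x z" "y \<noteq> z"
  shows "adj v u \<longleftrightarrow> u = x \<or> u = y \<or> u = z" "adj x u \<longleftrightarrow> u = v \<or> u = y \<or> u = z"
    "center v" "center x" "\<not> center y" "\<not> center z"
proof -
  note A = tri_adj[OF assms(1)] tri_adj[OF assms(2)] assms(3)
  show v: "adj v u \<longleftrightarrow> u = x \<or> u = y \<or> u = z" for u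
    using A nbr_cases[of v x y z u] by auto
  show x: "adj x u \<longleftrightarrow> u = v \<or> u = y \<or> u = z" for u
    using A nbr_cases[of x v y z u] by auto
  show "center v" "center x"
    using assms tri_sym unfolding center_def by blast+
  \<comment> \<open>If the tip \<open>y'\<close> were a centre, its third neighbour would be
    adjacent to \<open>v\<close> or \<open>x\<close> and hence be the other tip, which gives a
    K4.\<close>
  have nc: "\<not> center y'" if "tri v x y'" "tri v x z'" "y' \<noteq> z'" for y' z'
  proof
    assume "center y'"
    note B = tri_adj[OF that(1)] tri_adj[OF that(2)] that(3) no_K4[OF that]
    have v: "adj v u \<longleftrightarrow> u = x \<or> u = y' \<or> u = z'" for u
      using B nbr_cases[of v x y' z' u] by auto
    have x: "adj x u \<longleftrightarrow> u = v \<or> u = y' \<or> u = z'" for u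
      using B nbr_cases[of x v y' z' u] by auto
    obtain p q r where pqr: "tri y' p q" "tri y' p r" "q \<noteq> r"
      using \<open>center y'\<close> by (auto simp: center_def)
    note C = tri_adj[OF pqr(1)] tri_adj[OF pqr(2)] pqr(3)
    have "v = p \<or> v = q \<or> v = r" "x = p \<or> x = q \<or> x = r"
      using nbr_cases[of y' p q r] B C by auto
    then show False using B C v x by (metis)
  qed
  show "\<not> center y" "\<not> center z" using nc assms by blast+
qed

lemma tri_out_nbrs:
  assumes "tri v x y" "out v z"
  shows "adj v u \<longleftrightarrow> u = x \<or> u = y \<or> u = z" "vdegree E v = 3"
proof -
  note A = tri_adj[OF assms(1)] out_adj[OF assms(2)] out_not_tri[OF assms(2,1)]
  show "adj v u \<longleftrightarrow> u = x \<or> u = y \<or> u = z" using A nbr_cases[of v x y z u] by auto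
  show "vdegree E v = 3" using A by (intro degree3I[of v x y z]) auto
qed

lemma out_unique:
  assumes "tri v x y" "out v z" "out v z'"
  shows "z = z'"
  using tri_out_nbrs(1)[OF assms(1,2), of z'] out_not_tri[OF assms(3,1)] out_adj[OF assms(3)] by blast

lemma not_center_tri_unique:
  assumes "\<not> center v" "tri v x y" "tri v a b"
  shows "{a, b} = {x, y}"
proof -
  note A = tri_adj[OF assms(2)] tri_adj[OF assms(3)]
  have "a = x \<or> a = y \<or> b = x \<or> b = y"
    using A nbr_cases[of v x y a b] by auto
  moreover have "b = y" if "a = x" using that assms unfolding center_def by blast
  moreover have "b = x" if "a = y" using that assms tri_sym(2) unfolding center_def by metis
  moreover have "a = y" if "b = x" using that assms tri_sym(2) unfolding center_def by metis
  moreover have "a = x" if "b = y" using that assms tri_sym(2) unfolding center_def by metis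
  ultimately show ?thesis by blast
qed

lemma not_center_nbr:
  assumes "\<not> center v" "tri v x y" "adj v z"
  shows "z = x \<or> z = y \<or> out v z"
proof (rule ccontr)
  assume H: "\<not> ?thesis"
  then obtain w where "tri v z w" using assms(3) unfolding out_def tri_def by blast
  then show False using not_center_tri_unique[OF assms(1,2)] H by blast
qed

lemma center_not_out:
  assumes "center v" shows "\<not> out v z"
proof
  assume z: "out v z"
  obtain p q r where D: "tri v p q" "tri v p r" "q \<noteq> r" using assms unfolding center_def by blast
  show False
    using center_diamond(1)[OF D, of z] out_adj(1)[OF z] out_not_tri[OF z D(1)] out_not_tri[OF z D(2)] by blast
qed

lemma center_tri: "center v \<Longrightarrow> \<exists>x y. tri v x y"
  unfolding center_def by blast

lemma center_inner: "center v \<Longrightarrow> inner v"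
  unfolding inner_def using center_not_out center_tri by simp

lemma soft_hard_disjoint:
  assumes "tri v x y" "soft v" shows "\<not> hard v"
  using assms(2) out_unique[OF assms(1)] unfolding soft_def hard_def by metis

lemma not_inner_cases: "tri v x y \<Longrightarrow> \<not> inner v \<Longrightarrow> soft v \<or> hard v"
  by (auto simp: inner_def soft_def hard_def)

text \<open>The tips of a diamond are not centres, so both of its triangles contain the same two
  centres. This makes a choice among centres agree on the two triangles.\<close>

lemma centers_of_tri:
  assumes "center s" "tri s a b" "tri s c d"
  shows "{v \<in> {s, a, b}. center v} = {v \<in> {s, c, d}. center v}"
proof -
  obtain x y z where D: "tri s x y" "tri s x z" "y \<noteq> z"
    using assms(1) by (auto simp: center_def)
  note C = center_diamond[OF D] no_K4[OF D]
  have "{v \<in> {s, a, b}. center v} = {s, x}" if "tri s a b" for a b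
  proof -
    note A = tri_adj[OF that]
    have "a = x \<or> a = y \<or> a = z" "b = x \<or> b = y \<or> b = z" using A C(1) by auto
    moreover have "\<not> adj y z" "\<not> adj z y" using C(7) adj_sym by blast+
    ultimately have "a = x \<and> b \<in> {y, z} \<or> b = x \<and> a \<in> {y, z}" using A by auto
    then show ?thesis using C(3-6) assms(1) by auto
  qed
  then show ?thesis using assms by simp
qed

section \<open>Independent transversals of the triangles\<close>

text \<open>The preference for soft vertices is left to the existence proof, because later exchanges
  inside a triangle must be free to break it.\<close>

definition valid :: "'a set \<Rightarrow> bool" where
  "valid T \<longleftrightarrow> (\<forall>t\<in>T. \<exists>x y. tri t x y) \<and> (\<forall>s\<in>T. \<forall>t\<in>T. \<not> adj s t) \<and>
     (\<forall>x y z. tri x y z \<longrightarrow> x \<in> T \<or> y \<in> T \<or> z \<in> T) \<and>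
     (\<forall>t\<in>T. \<forall>x y. tri t x y \<longrightarrow> (center x \<longrightarrow> center t) \<and> (inner x \<longrightarrow> inner t))"

text \<open>The order ensures that a hard vertex is chosen only if all three vertices of the
  triangle are hard.\<close>

definition preferred :: "'a set \<Rightarrow> 'a set" where
  "preferred D = (if \<exists>v\<in>D. center v then {v \<in> D. center v}
     else if \<exists>v\<in>D. inner v then {v \<in> D. inner v}
     else if \<exists>v\<in>D. soft v then {v \<in> D. soft v} else D)"

lemma hard_tri_heavy:
  assumes "tri s x y" "hard s" "hard x" "hard y"
  shows "heavy E s"
proof -
  obtain z where z: "out s z" "vdegree E z = 3" using assms by (auto simp: hard_def)
  have "vdegree E x = 3" "vdegree E y = 3"
    using assms tri_out_nbrs(2) tri_sym unfolding hard_def by metis+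
  then show ?thesis
    using heavyI[of s x y z] tri_adj[OF assms(1)] out_adj[OF z(1)] z(2) out_not_tri[OF z(1) assms(1)] by blast
qed

text \<open>The point is independence. Two chosen vertices joined by an outgoing edge are both hard,
  so their triangles are entirely hard and consist of heavy vertices; each end would then have three
  heavy neighbours.\<close>

lemma valid_exists: "\<exists>T. valid T"
proof -
  \<comment> \<open>The choice depends on \<open>preferred D\<close> only, so the two triangles of a
    diamond yield the same centre.\<close>
  define f where "f D = (SOME v. v \<in> preferred D)" for D
  define T where "T = {f {x, y, z} | x y z. tri x y z}"
  have f: "f D \<in> preferred D" if "D \<noteq> {}" for D
  proof -
    have "\<exists>v. v \<in> preferred D" using that unfolding preferred_def by (simp split: if_split) blast
    then show ?thesis unfolding f_def by (rule someI_ex)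
  qed
  have pref_sub: "preferred D \<subseteq> D" for D unfolding preferred_def by (simp split: if_split)
  have T_tri: "\<exists>x y. tri t x y \<and> t = f {t, x, y}" if t: "t \<in> T" for t
  proof -
    obtain x y z where xyz: "tri x y z" "t = f {x, y, z}" using t by (auto simp: T_def)
    have "t \<in> {x, y, z}" using f[of "{x, y, z}"] pref_sub xyz by blast
    then consider "t = x" | "t = y" | "t = z" by auto
    then show ?thesis
    proof cases
      case 1 then show ?thesis using xyz by blast
    next
      case 2
      have "{x, y, z} = {y, x, z}" by auto
      then show ?thesis using xyz 2 tri_sym by metis
    next
      case 3
      have "{x, y, z} = {z, x, y}" by auto
      then show ?thesis using xyz 3 tri_sym by metis
    qed
  qed
  have T_pref: "t \<in> preferred {t, x, y}" if "t \<in> T" "tri t x y" for t x y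
  proof -
    obtain a b where ab: "tri t a b" "t = f {t, a, b}" using T_tri \<open>t \<in> T\<close> by blast
    then have ta: "t \<in> preferred {t, a, b}" using f[of "{t, a, b}"] by simp
    show ?thesis
    proof (cases "center t")
      case True then show ?thesis by (auto simp: preferred_def)
    next
      case False
      then have "{a, b} = {x, y}" using not_center_tri_unique ab(1) that(2) by metis
      then show ?thesis using ta by simp
    qed
  qed
  have hits: "x \<in> T \<or> y \<in> T \<or> z \<in> T" if "tri x y z" for x y z
  proof -
    have "f {x, y, z} \<in> T" using that by (auto simp: T_def)
    moreover have "f {x, y, z} \<in> {x, y, z}" using f[of "{x, y, z}"] pref_sub by blast
    ultimately show ?thesis by auto
  qed
  have pref: "(center x \<longrightarrow> center t) \<and> (inner x \<longrightarrow> inner t)" if "t \<in> T" "tri t x y" for t x y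
    using T_pref[OF that] center_inner[of t] by (auto simp: preferred_def split: if_splits)
  have heavy: "heavy E t \<and> heavy E x \<and> heavy E y"
    if "t \<in> T" "tri t x y" "out t z" "vdegree E z = 3" for t x y z
  proof -
    have "hard t" using that by (auto simp: hard_def)
    then have ns: "\<not> soft t" using soft_hard_disjoint that(2) by blast
    have "\<not> inner t" using that by (auto simp: inner_def)
    then have "\<not> soft x" "\<not> soft y" "\<not> inner x" "\<not> inner y"
      using T_pref[OF that(1,2)] ns center_inner by (auto simp: preferred_def split: if_splits)
    then have "hard x" "hard y" using not_inner_cases that(2) tri_sym by metis+
    then show ?thesis using hard_tri_heavy that(2) \<open>hard t\<close> tri_sym by metis
  qed
  have indep: "\<not> adj s t" if st: "s \<in> T" "t \<in> T" for s t
  proof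
    assume A: "adj s t"
    obtain a b where ab: "tri s a b" "s = f {s, a, b}" using T_tri st by blast
    obtain c d where cd: "tri t c d" "t = f {t, c, d}" using T_tri st by blast
    show False
    proof (cases "out s t")
      case True
      note o = True out_sym[OF True]
      have D: "vdegree E s = 3" "vdegree E t = 3" using tri_out_nbrs(2) ab(1) cd(1) o by blast+
      have "heavy E s" "heavy E a" "heavy E b" "heavy E t"
        using heavy[OF st(1) ab(1) o(1) D(2)] heavy[OF st(2) cd(1) o(2) D(1)] by auto
      then show False
        using heavy_neighbours[of s a b t] tri_adj[OF ab(1)] A out_not_tri[OF o(1) ab(1)] by blast
    next
      case False
      then obtain w where w: "tri s t w" using A unfolding out_def tri_def by blast
      then have w': "tri t s w" by (rule tri_sym)
      have sw: "{s, t, w} = {t, s, w}" by auto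
      show False
      proof (cases "center s")
        case True
        then have "center t" using pref[OF st(2) w'] by blast
        have "{v \<in> {s, a, b}. center v} = {v \<in> {t, c, d}. center v}"
          using centers_of_tri[OF True ab(1) w] centers_of_tri[OF \<open>center t\<close> cd(1) w'] sw by simp
        then have "preferred {s, a, b} = preferred {t, c, d}"
          using True \<open>center t\<close> unfolding preferred_def by auto
        then show False using ab(2) cd(2) A by (simp add: f_def)
      next
        case False
        then have "\<not> center t" using pref[OF st(1) w] by blast
        then have "{c, d} = {s, w}" "{a, b} = {t, w}"
          using not_center_tri_unique[OF False w ab(1)] not_center_tri_unique[OF _ w' cd(1)] by auto
        then have "{s, a, b} = {t, c, d}" by auto
        then show False using ab(2) cd(2) A by (metis adj_irrefl)
      qed
    qed
  qed
  have "valid T" unfolding valid_def using T_tri indep hits pref by blast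
  then show ?thesis by blast
qed

lemma valid_tri: "valid T \<Longrightarrow> t \<in> T \<Longrightarrow> \<exists>x y. tri t x y"
  and valid_indep: "valid T \<Longrightarrow> s \<in> T \<Longrightarrow> t \<in> T \<Longrightarrow> \<not> adj s t"
  and valid_hit: "valid T \<Longrightarrow> tri x y z \<Longrightarrow> x \<in> T \<or> y \<in> T \<or> z \<in> T"
  and valid_center: "valid T \<Longrightarrow> t \<in> T \<Longrightarrow> tri t x y \<Longrightarrow> center x \<Longrightarrow> center t"
  and valid_inner: "valid T \<Longrightarrow> t \<in> T \<Longrightarrow> tri t x y \<Longrightarrow> inner x \<Longrightarrow> inner t"
  unfolding valid_def by blast+

lemma valid_finite: "valid T \<Longrightarrow> finite T"
  by (rule finite_subset[OF _ finite_V]) (use valid_tri tri_adj(1) adj_V(1) in blast)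

section \<open>Elements of the transversal seen through an outgoing edge\<close>

lemma low_degree_not_tri: "out x z \<Longrightarrow> vdegree E z \<noteq> 3 \<Longrightarrow> \<not> tri z a b"
  using tri_out_nbrs(2) out_sym by blast

text \<open>If \<open>z\<close> is on a triangle, both candidates lie in this clique, of which the
  independent \<open>T\<close> contains at most one vertex. Otherwise \<open>z\<close> is outside
  \<open>T\<close> and has at most one neighbour besides \<open>x\<close>.\<close>

lemma reach_unique:
  assumes "valid T" "out x z" "s \<in> T" "s' \<in> T" "s \<noteq> x" "s' \<noteq> x"
    and "s = z \<or> adj z s" "s' = z \<or> adj z s'"
  shows "s = s'"
proof (cases "\<exists>p q. tri z p q")
  case True
  then obtain p q where pq: "tri z p q" by blast
  have "s \<in> {z, p, q}" "s' \<in> {z, p, q}"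
    using tri_out_nbrs(1)[OF pq out_sym[OF assms(2)]] assms by auto
  then show ?thesis using valid_indep[OF assms(1,3,4)] tri_adj[OF pq] by auto
next
  case False
  then have "z \<notin> T" using valid_tri assms(1) by blast
  moreover have "vdegree E z \<noteq> 3" using False degree3_tri by blast
  ultimately show ?thesis
    using degree3I[of z x s s'] assms out_adj[OF assms(2)] by auto
qed

text \<open>Radius 2 through the exit of \<open>x\<close>. The other vertices of its triangle are
  one step away from \<open>x\<close>, so this is what they see there within distance 3.\<close>

definition reach :: "'a \<Rightarrow> 'a set" where
  "reach x = {s. s \<noteq> x \<and> (\<exists>z. out x z \<and> (s = z \<or> adj z s))}"

text \<open>Radius 3 through the exit of \<open>x\<close>; \<open>u \<noteq> x\<close> forbids
  turning back into the triangle.\<close>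

definition reach2 :: "'a \<Rightarrow> 'a set" where
  "reach2 x = {s. s \<noteq> x \<and> (\<exists>z. out x z \<and>
     (s = z \<or> adj z s \<or> (\<exists>u. u \<noteq> x \<and> adj z u \<and> adj u s)))}"

lemma card_le_1I: "(\<And>x y. x \<in> A \<Longrightarrow> y \<in> A \<Longrightarrow> x = y) \<Longrightarrow> card A \<le> 1"
  by (cases "finite A") (auto simp: card_le_Suc0_iff_eq)

lemma card_reach:
  assumes "valid T" "tri x a b"
  shows "card (T \<inter> reach x) \<le> 1"
proof (rule card_le_1I)
  fix s s' assume H: "s \<in> T \<inter> reach x" "s' \<in> T \<inter> reach x"
  then obtain z where z: "out x z" "s = z \<or> adj z s" by (auto simp: reach_def)
  have "s' = z \<or> adj z s'" using H out_unique[OF assms(2) z(1)] unfolding reach_def by blast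
  then show "s = s'" using reach_unique[OF assms(1) z(1), of s s'] z(2) H by (auto simp: reach_def)
qed

text \<open>The exit vertex \<open>z\<close> is on no triangle and has at most one neighbour
  \<open>u\<close> besides \<open>t\<close>. The edge from \<open>z\<close> to \<open>u\<close> is
  again outgoing, so \<open>reach_unique\<close> applies one step further.\<close>

lemma card_reach2_soft:
  assumes "valid T" "tri t a b" "soft t"
  shows "card (T \<inter> reach2 t) \<le> 1"
proof -
  obtain z where z: "out t z" "vdegree E z \<noteq> 3" using assms by (auto simp: soft_def)
  have nt: "\<not> tri z p q" for p q using low_degree_not_tri z by blast
  then have zT: "z \<notin> T" using valid_tri assms(1) by blast
  have step: "\<exists>u. adj z u \<and> u \<noteq> t \<and> (s = u \<or> adj u s)" if "s \<in> T" "s \<in> reach2 t" for s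
    using that zT out_unique[OF assms(2) z(1)] unfolding reach2_def by blast
  show ?thesis
  proof (rule card_le_1I)
    fix s s' assume H: "s \<in> T \<inter> reach2 t" "s' \<in> T \<inter> reach2 t"
    obtain u where u: "adj z u" "u \<noteq> t" "s = u \<or> adj u s" using step[of s] H by auto
    obtain u' where u': "adj z u'" "u' \<noteq> t" "s' = u' \<or> adj u' s'" using step[of s'] H by auto
    have "u = u'" using degree3I[of z t u u'] u u' z(2) out_adj[OF z(1)] by auto
    moreover have "out z u" using u(1) nt unfolding out_def tri_def by blast
    moreover have "s \<noteq> z" "s' \<noteq> z" using H zT by auto
    ultimately show "s = s'" using reach_unique[OF assms(1), of z u s s'] u u' H by auto
  qed
qed

text \<open>A hard exit can show two elements: \<open>p\<close> and one beyond \<open>q\<close>. If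
  \<open>q\<close> is a centre, preference makes \<open>p\<close> the other centre, which is
  adjacent to all other neighbours of \<open>q\<close>, so none of these is in
  \<open>T\<close>.\<close>

lemma reach2_hard:
  assumes "valid T" "x \<in> T" "out x z" "tri z p q" "p \<in> T" "s \<in> T" "s \<in> reach2 x" "tri x a b"
  shows "s = p \<or> out q s"
proof -
  have N: "adj z u \<longleftrightarrow> u = p \<or> u = q \<or> u = x" for u
    using tri_out_nbrs(1)[OF assms(4) out_sym[OF assms(3)]] .
  note A = tri_adj[OF assms(4)]
  have zT: "z \<notin> T" using valid_indep[OF assms(1,2)] out_adj[OF assms(3)] by blast
  have qT: "q \<notin> T" using valid_indep[OF assms(1,5)] A by blast
  have "s \<noteq> x" and "s = z \<or> adj z s \<or> (\<exists>u. u \<noteq> x \<and> adj z u \<and> adj u s)"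
    using assms(7) out_unique[OF assms(8) _ assms(3)] by (auto simp: reach2_def)
  then consider "s = p" | "adj p s" | "adj q s" using zT qT N assms(6) by auto
  then show ?thesis
  proof cases
    case 2 then show ?thesis using valid_indep[OF assms(1,5,6)] by blast
  next
    case 3
    have qpz: "tri q p z" using assms(4) tri_sym by blast
    show ?thesis
    proof (cases "center q")
      case True
      have pqz: "tri p q z" using assms(4) tri_sym by blast
      have "center p" using valid_center[OF assms(1,5) pqz True] .
      then obtain w where w: "tri q p w" "w \<noteq> z"
      proof -
        assume *: "\<And>w. tri q p w \<Longrightarrow> w \<noteq> z \<Longrightarrow> thesis"
        obtain x' y' z' where D: "tri q x' y'" "tri q x' z'" "y' \<noteq> z'" using True by (auto simp: center_def)
        have "p = x'" using center_diamond[OF D] \<open>center p\<close> A by metis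
        then show thesis using * D by metis
      qed
      have "s = p \<or> s = z \<or> s = w" using center_diamond(1)[OF qpz w(1)] w 3 by auto
      then show ?thesis using zT assms(6) w tri_adj[OF w(1)] valid_indep[OF assms(1,5,6)] by auto
    next
      case False
      then show ?thesis using not_center_nbr[OF False qpz 3] zT assms(6) by auto
    qed
  qed auto
qed

section \<open>Conflicts and exchanges\<close>

definition conflicts :: "'a set \<Rightarrow> 'a \<Rightarrow> 'a set" where
  "conflicts T t = {s \<in> T. s \<noteq> t \<and> near t s}"

definition conflict_pairs :: "'a set \<Rightarrow> 'a set set" where
  "conflict_pairs T = {{a, b} | a b. a \<in> T \<and> b \<in> T \<and> a \<noteq> b \<and> near a b}"

definition swap :: "'a set \<Rightarrow> 'a \<Rightarrow> 'a \<Rightarrow> 'a set" where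
  "swap T t x = insert x (T - {t})"

lemma card_conflict_pairs_insert:
  assumes "finite T" "a \<notin> T"
  shows "card (conflict_pairs (insert a T)) = card (conflict_pairs T) + card (conflicts T a)"
proof -
  let ?f = "\<lambda>b. {a, b}"
  have eq: "conflict_pairs (insert a T) = conflict_pairs T \<union> ?f ` conflicts T a"
  proof (rule set_eqI, rule iffI)
    fix e assume "e \<in> conflict_pairs (insert a T)"
    then obtain b c where "e = {b, c}" "b \<in> insert a T" "c \<in> insert a T" "b \<noteq> c" "near b c"
      unfolding conflict_pairs_def by blast
    then show "e \<in> conflict_pairs T \<union> ?f ` conflicts T a"
      using near_sym[of b c] unfolding conflict_pairs_def conflicts_def by blast
  next
    fix e assume "e \<in> conflict_pairs T \<union> ?f ` conflicts T a"
    then show "e \<in> conflict_pairs (insert a T)"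
      unfolding conflict_pairs_def conflicts_def by blast
  qed
  have "finite (conflict_pairs T)"
    by (rule finite_subset[of _ "Pow T"]) (auto simp: conflict_pairs_def assms)
  moreover have "conflict_pairs T \<inter> ?f ` conflicts T a = {}"
    using assms(2) unfolding conflict_pairs_def by (auto simp: doubleton_eq_iff)
  moreover have "inj_on ?f (conflicts T a)"
    by (auto simp: inj_on_def doubleton_eq_iff)
  ultimately show ?thesis
    unfolding eq using assms(1) by (simp add: card_Un_disjoint card_image conflicts_def)
qed

lemma card_conflict_pairs_swap:
  assumes "finite T" "t \<in> T" "x \<notin> T"
  shows "card (conflict_pairs (swap T t x)) + card (conflicts T t) =
    card (conflict_pairs T) + card (conflicts (swap T t x) x)"
proof -
  have "T = insert t (T - {t})" using assms by auto
  then have "card (conflict_pairs T) = card (conflict_pairs (T - {t})) + card (conflicts (T - {t}) t)"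
    using card_conflict_pairs_insert[of "T - {t}" t] assms(1) by simp
  moreover have "card (conflict_pairs (swap T t x)) =
      card (conflict_pairs (T - {t})) + card (conflicts (T - {t}) x)"
    unfolding swap_def using card_conflict_pairs_insert[of "T - {t}" x] assms by simp
  moreover have "conflicts (T - {t}) t = conflicts T t"
    "conflicts (swap T t x) x = conflicts (T - {t}) x"
    by (auto simp: conflicts_def swap_def)
  ultimately show ?thesis by simp
qed

lemma not_inner_out: "tri v x y \<Longrightarrow> \<not> inner v \<Longrightarrow> \<exists>z. out v z"
  unfolding inner_def by blast

text \<open>A walk leaving through \<open>x\<close> or \<open>y\<close> has spent one step inside
  the triangle, which leaves radius 2 there. Only the exit of \<open>t\<close> itself offers the
  full radius 3.\<close>

lemma near_exits:
  assumes "tri t x y" "out t z" "out x zx" "out y zy" and "near t s" "s \<noteq> t" "s \<noteq> x" "s \<noteq> y"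
  shows "s \<in> reach2 t \<union> reach x \<union> reach y"
proof -
  have T: "tri x t y" "tri y t x" using assms(1) tri_sym by blast+
  have N: "\<And>u. adj t u \<Longrightarrow> u = x \<or> u = y \<or> u = z" "\<And>u. adj x u \<Longrightarrow> u = t \<or> u = y \<or> u = zx"
    "\<And>u. adj y u \<Longrightarrow> u = t \<or> u = x \<or> u = zy"
    using tri_out_nbrs(1)[OF assms(1,2)] tri_out_nbrs(1)[OF T(1) assms(3)]
      tri_out_nbrs(1)[OF T(2) assms(4)] by blast+
  have R: "s \<in> reach2 t" if "s = z \<or> adj z s \<or> (\<exists>u. u \<noteq> t \<and> adj z u \<and> adj u s)"
    using that assms(2,6) unfolding reach2_def by blast
  have Rx: "s \<in> reach x" if "s = zx \<or> adj zx s" using that assms(3,7) unfolding reach_def by blast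
  have Ry: "s \<in> reach y" if "s = zy \<or> adj zy s" using that assms(4,8) unfolding reach_def by blast
  have step: "s \<in> reach2 t \<union> reach x \<union> reach y" if st: "adj t a" "s = a \<or> adj a s \<or> (\<exists>b. adj a b \<and> adj b s)" for a
  proof -
    consider "a = x" | "a = y" | "a = z" using N(1) st(1) by blast
    then show ?thesis
    proof cases
      case 1
      have "s = zx \<or> (\<exists>b. (b = t \<or> b = y \<or> b = zx) \<and> adj b s)"
        using st(2) assms(6,7,8) N(2) 1 by blast
      then show ?thesis using N(1,3)[of s] assms(6,7,8) R Rx Ry by blast
    next
      case 2
      have "s = zy \<or> (\<exists>b. (b = t \<or> b = x \<or> b = zy) \<and> adj b s)"
        using st(2) assms(6,7,8) N(3) 2 by blast
      then show ?thesis using N(1,2)[of s] assms(6,7,8) R Rx Ry by blast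
    next
      case 3
      have "s = z \<or> adj z s \<or> (\<exists>b. (b = t \<or> b \<noteq> t) \<and> adj z b \<and> adj b s)"
        using st(2) 3 by blast
      then show ?thesis using N(1)[of s] assms(7,8) R by blast
    qed
  qed
  show ?thesis using assms(5,6) step unfolding near_def by blast
qed

lemma valid_not_inner:
  assumes "valid T" "t \<in> T" "tri t x y" "\<not> inner t"
  shows "\<not> inner x" "\<not> inner y"
  using valid_inner[OF assms(1,2)] assms(3,4) tri_sym(2) by blast+

lemma conflicts_exits:
  assumes "valid T" "t \<in> T" "tri t x y" "\<not> inner t"
  shows "conflicts T t \<subseteq> T \<inter> reach2 t \<union> T \<inter> reach x \<union> T \<inter> reach y"
proof
  fix s assume s: "s \<in> conflicts T t"
  have T: "tri x t y" "tri y t x" using assms(3) tri_sym by blast+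
  obtain z zx zy where "out t z" "out x zx" "out y zy"
    using not_inner_out[OF assms(3,4)] not_inner_out[OF T(1)] not_inner_out[OF T(2)]
      valid_not_inner[OF assms] by blast
  moreover have "s \<in> T" "s \<noteq> t" "near t s" using s by (auto simp: conflicts_def)
  moreover have "s \<noteq> x" "s \<noteq> y"
    using valid_indep[OF assms(1,2) \<open>s \<in> T\<close>] tri_adj[OF assms(3)] by blast+
  ultimately show "s \<in> T \<inter> reach2 t \<union> T \<inter> reach x \<union> T \<inter> reach y"
    using near_exits[OF assms(3)] by blast
qed

lemma card_subset_Un2:
  assumes "finite A" "finite B" "C \<subseteq> A \<union> B"
  shows "card C \<le> card A + card B"
  using card_mono[of "A \<union> B" C] card_Un_le[of A B] assms by simp

lemma card_subset_Un3:
  assumes "finite A" "finite B" "finite D" "C \<subseteq> A \<union> B \<union> D"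
  shows "card C \<le> card A + card B + card D"
  using card_subset_Un2[of "A \<union> B" D C] card_Un_le[of A B] assms by simp

text \<open>An inner vertex has no exit of its own. It sees \<open>T\<close> only through the two
  tips of its diamond, or through the two other vertices of its triangle, with at most one element
  each.\<close>

lemma card_conflicts_inner:
  assumes "valid T" "t \<in> T" "inner t"
  shows "card (conflicts T t) \<le> 2"
proof -
  have sub: "\<exists>x y. conflicts T t \<subseteq> T \<inter> reach x \<union> T \<inter> reach y \<and> (\<exists>a b. tri x a b) \<and> (\<exists>a b. tri y a b)"
  proof (cases "center t")
    case True
    then obtain x y z where D: "tri t x y" "tri t x z" "y \<noteq> z" unfolding center_def by blast
    note C = center_diamond[OF D]
    have T: "tri y t x" "tri z t x" using D tri_sym by blast+
    have "s \<in> reach y \<union> reach z" if s: "s \<in> conflicts T t" for s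
    proof -
      have s': "s \<in> T" "s \<noteq> t" "near t s" using s by (auto simp: conflicts_def)
      have ne: "s \<noteq> x" "s \<noteq> y" "s \<noteq> z"
        using valid_indep[OF assms(1,2) s'(1)] tri_adj[OF D(1)] tri_adj[OF D(2)] by blast+
      have Ny: "u = t \<or> u = x \<or> out y u" if "adj y u" for u using not_center_nbr[OF C(5) T(1) that] .
      have Nz: "u = t \<or> u = x \<or> out z u" if "adj z u" for u using not_center_nbr[OF C(6) T(2) that] .
      have Nt: "u = x \<or> u = y \<or> u = z" if "adj t u" for u using C(1) that by blast
      have Nx: "u = t \<or> u = y \<or> u = z" if "adj x u" for u using C(2) that by blast
      obtain a b where ab: "adj t a" "adj a b" "s = b \<or> adj b s"
        using s'(2,3) ne Nt unfolding near_def by blast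
      then have "a = x \<or> a = y \<or> a = z" using Nt by blast
      then have "b = t \<or> b = x \<or> b = y \<or> b = z \<or> out y b \<or> out z b"
        using Nx Ny Nz ab(2) by blast
      then show ?thesis
        using ab(3) ne s'(2) Nt[of s] Nx[of s] Ny[of s] Nz[of s] unfolding reach_def by blast
    qed
    then have "conflicts T t \<subseteq> T \<inter> reach y \<union> T \<inter> reach z" by (auto simp: conflicts_def)
    then show ?thesis using T by blast
  next
    case False
    obtain x y where xy: "tri t x y" using valid_tri assms by blast
    have T: "tri x t y" "tri y t x" "tri t y x" using xy tri_sym by blast+
    have nc: "\<not> center x" "\<not> center y" using valid_center[OF assms(1,2)] xy T(3) False by blast+
    have "s \<in> reach x \<union> reach y" if s: "s \<in> conflicts T t" for s
    proof -
      have s': "s \<in> T" "s \<noteq> t" "near t s" using s by (auto simp: conflicts_def)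
      have ne: "s \<noteq> x" "s \<noteq> y"
        using valid_indep[OF assms(1,2) s'(1)] tri_adj[OF xy] by blast+
      have Nt: "u = x \<or> u = y" if "adj t u" for u
        using not_center_nbr[OF False xy that] assms(3) unfolding inner_def by blast
      have Nx: "u = t \<or> u = y \<or> out x u" if "adj x u" for u using not_center_nbr[OF nc(1) T(1) that] .
      have Ny: "u = t \<or> u = x \<or> out y u" if "adj y u" for u using not_center_nbr[OF nc(2) T(2) that] .
      obtain a b where ab: "adj t a" "adj a b" "s = b \<or> adj b s"
        using s'(2,3) ne Nt unfolding near_def by blast
      then have "a = x \<or> a = y" using Nt by blast
      then have "b = t \<or> b = x \<or> b = y \<or> out x b \<or> out y b" using Nx Ny ab(2) by blast
      then show ?thesis
        using ab(3) ne s'(2) Nt[of s] Nx[of s] Ny[of s] unfolding reach_def by blast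
    qed
    then have "conflicts T t \<subseteq> T \<inter> reach x \<union> T \<inter> reach y" by (auto simp: conflicts_def)
    then show ?thesis using T by blast
  qed
  then obtain x y a b c d where *: "conflicts T t \<subseteq> T \<inter> reach x \<union> T \<inter> reach y" "tri x a b" "tri y c d"
    by blast
  show ?thesis
    using card_subset_Un2[OF _ _ *(1)] card_reach[OF assms(1) *(2)] card_reach[OF assms(1) *(3)]
      valid_finite[OF assms(1)] by simp
qed

lemma card_conflicts_le:
  assumes "valid T" "t \<in> T" "tri t x y" "\<not> inner t"
  shows "card (conflicts T t) \<le> card (T \<inter> reach2 t) + card (T \<inter> reach x) + card (T \<inter> reach y)"
  using card_subset_Un3[OF _ _ _ conflicts_exits[OF assms]] valid_finite[OF assms(1)] by simp

lemma soft_not_inner: "soft v \<Longrightarrow> \<not> inner v" and hard_not_inner: "hard v \<Longrightarrow> \<not> inner v"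
  unfolding soft_def hard_def inner_def by blast+

lemma card_conflicts_soft:
  assumes "valid T" "t \<in> T" "soft t"
  shows "card (conflicts T t) \<le> 3"
proof -
  obtain x y where xy: "tri t x y" using valid_tri assms by blast
  have T: "tri x t y" "tri y t x" using xy tri_sym by blast+
  show ?thesis
    using card_conflicts_le[OF assms(1,2) xy soft_not_inner[OF assms(3)]] card_reach2_soft[OF assms(1) xy assms(3)]
      card_reach[OF assms(1) T(1)] card_reach[OF assms(1) T(2)] by linarith
qed

text \<open>As \<open>t\<close> is not inner, no vertex of the triangle is a centre, so
  \<open>t\<close> and \<open>x\<close> hit one and the same triangle. The only neighbour of
  \<open>x\<close> outside it is \<open>z\<close>, hence the condition
  \<open>z \<notin> T\<close>.\<close>

lemma valid_swap:
  assumes "valid T" "t \<in> T" "tri t x y" "\<not> inner t" "out x z" "z \<notin> T"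
  shows "valid (swap T t x)"
proof -
  have T: "tri x t y" "tri y t x" using assms(3) tri_sym by blast+
  have ni: "\<not> inner x" "\<not> inner y" using valid_not_inner[OF assms(1-4)] .
  have nc: "\<not> center t" "\<not> center x" "\<not> center y" using ni assms(4) center_inner by blast+
  have indep: "\<not> adj x u" if "u \<in> T" "u \<noteq> t" for u
    using tri_out_nbrs(1)[OF T(1) assms(5), of u] that assms(6) valid_indep[OF assms(1,2), of y]
      tri_adj[OF assms(3)] by blast
  have tx: "x \<in> {t, a, b}" if "tri t a b" for a b
    using not_center_tri_unique[OF nc(1) assms(3) that] by blast
  have hit: "a = x \<or> b = x \<or> c = x \<or> a \<in> T \<and> a \<noteq> t \<or> b \<in> T \<and> b \<noteq> t \<or> c \<in> T \<and> c \<noteq> t"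
    if abc: "tri a b c" for a b c
  proof (cases "t \<in> {a, b, c}")
    case True
    then show ?thesis using tx[of b c] tx[of a c] tx[of a b] abc tri_sym[OF abc] tri_adj(7)[OF assms(3)] by auto
  next
    case False
    then show ?thesis using valid_hit[OF assms(1) abc] by auto
  qed
  have pr: "\<not> center a \<and> \<not> inner a" if "tri x a b" for a b
  proof -
    have "a \<in> {t, y}" using not_center_tri_unique[OF nc(2) T(1) that] by blast
    then show ?thesis using nc ni assms(4) by auto
  qed
  show ?thesis
    unfolding valid_def swap_def
  proof (intro conjI ballI allI impI)
    fix s assume "s \<in> insert x (T - {t})"
    then show "\<exists>x y. tri s x y" using T(1) valid_tri[OF assms(1)] by blast
  next
    fix s u assume "s \<in> insert x (T - {t})" "u \<in> insert x (T - {t})"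
    then show "\<not> adj s u" using indep valid_indep[OF assms(1)] adj_sym adj_irrefl by blast
  next
    fix a b c assume "tri a b c"
    then show "a \<in> insert x (T - {t}) \<or> b \<in> insert x (T - {t}) \<or> c \<in> insert x (T - {t})"
      using hit by blast
  next
    fix s a b assume "s \<in> insert x (T - {t})" "tri s a b" "center a"
    then show "center s" using pr valid_center[OF assms(1)] by blast
  next
    fix s a b assume "s \<in> insert x (T - {t})" "tri s a b" "inner a"
    then show "inner s" using pr valid_inner[OF assms(1)] by blast
  qed
qed

section \<open>Optimal transversals and single exchanges\<close>

definition optimal :: "'a set \<Rightarrow> bool" where
  "optimal T \<longleftrightarrow> valid T \<and> (\<forall>T'. valid T' \<longrightarrow>
     card (conflict_pairs T) \<le> card (conflict_pairs T') \<and>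
     (card (conflict_pairs T') = card (conflict_pairs T) \<longrightarrow> card {t \<in> T. hard t} \<le> card {t \<in> T'. hard t}))"

lemma optimal_exists: "\<exists>T. optimal T"
proof -
  let ?m = "\<lambda>T. card (conflict_pairs T)"
  obtain T0 where T0: "valid T0" "\<forall>T. valid T \<longrightarrow> ?m T0 \<le> ?m T"
    using valid_exists ex_has_least_nat[of valid _ ?m] by blast
  then obtain T where T: "valid T \<and> ?m T = ?m T0"
    "\<forall>T'. valid T' \<and> ?m T' = ?m T0 \<longrightarrow> card {t \<in> T. hard t} \<le> card {t \<in> T'. hard t}"
    using ex_has_least_nat[of "\<lambda>T. valid T \<and> ?m T = ?m T0" T0 "\<lambda>T. card {t \<in> T. hard t}"] by blast
  then show ?thesis using T0 unfolding optimal_def by (intro exI[of _ T]) auto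
qed

lemma optimal_swap:
  assumes "optimal T" "t \<in> T" "tri t x y" "\<not> inner t" "out x z" "z \<notin> T"
  shows "card (conflicts T t) \<le> card (conflicts (swap T t x) x)"
proof -
  have v: "valid T" using assms by (simp add: optimal_def)
  have "x \<notin> T" using valid_indep[OF v assms(2)] tri_adj[OF assms(3)] by blast
  then have "card (conflict_pairs (swap T t x)) + card (conflicts T t) =
      card (conflict_pairs T) + card (conflicts (swap T t x) x)"
    using card_conflict_pairs_swap valid_finite[OF v] assms(2) by blast
  moreover have "card (conflict_pairs T) \<le> card (conflict_pairs (swap T t x))"
    using valid_swap[OF v assms(2-6)] assms(1) unfolding optimal_def by blast
  ultimately show ?thesis by linarith
qed

lemma low_degree_not_mem: "valid T \<Longrightarrow> out x z \<Longrightarrow> vdegree E z \<noteq> 3 \<Longrightarrow> z \<notin> T"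
  using low_degree_not_tri valid_tri by blast

text \<open>If \<open>t\<close> had three conflicts, exchanging it for the soft \<open>x\<close>,
  which has at most three, would not increase the conflict pairs but would save a hard element. This
  is what the secondary minimisation is for.\<close>

lemma card_conflicts_hard:
  assumes "optimal T" "t \<in> T" "tri t x y" "hard t" "soft x"
  shows "card (conflicts T t) \<le> 2"
proof (rule ccontr)
  assume "\<not> ?thesis"
  then have ge: "card (conflicts T t) \<ge> 3" by simp
  let ?T = "swap T t x"
  have v: "valid T" using assms by (simp add: optimal_def)
  obtain z where z: "out x z" "vdegree E z \<noteq> 3" using assms(5) by (auto simp: soft_def)
  have v': "valid ?T"
    using valid_swap[OF v assms(2,3) hard_not_inner[OF assms(4)] z(1) low_degree_not_mem[OF v z]] .
  have "x \<in> ?T" by (simp add: swap_def)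
  then have "card (conflicts ?T x) \<le> 3" using card_conflicts_soft v' assms(5) by blast
  moreover have "x \<notin> T" using valid_indep[OF v assms(2)] tri_adj[OF assms(3)] by blast
  then have "card (conflict_pairs ?T) + card (conflicts T t) =
      card (conflict_pairs T) + card (conflicts ?T x)"
    using card_conflict_pairs_swap valid_finite[OF v] assms(2) by blast
  ultimately have "card (conflict_pairs ?T) \<le> card (conflict_pairs T)" using ge by linarith
  then have le: "card {s \<in> T. hard s} \<le> card {s \<in> ?T. hard s}"
    using assms(1) v' unfolding optimal_def by (meson le_antisym)
  have "\<not> hard x" using soft_hard_disjoint tri_sym(1)[OF assms(3)] assms(5) by blast
  then have "{s \<in> ?T. hard s} \<subseteq> {s \<in> T. hard s}" unfolding swap_def by blast
  moreover have "t \<notin> ?T" using tri_adj(7)[OF assms(3)] by (simp add: swap_def)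
  ultimately have "{s \<in> ?T. hard s} \<subset> {s \<in> T. hard s}" using assms(2,4) by blast
  then have "card {s \<in> ?T. hard s} < card {s \<in> T. hard s}"
    using valid_finite[OF v] by (intro psubset_card_mono) simp_all
  then show False using le by simp
qed

text \<open>Since \<open>x\<close> is heavy with heavy neighbours \<open>s\<close> and
  \<open>y\<close>, saturation makes \<open>z\<close> not heavy. So a vertex of the triangle at
  \<open>z\<close> has degree 2 and is inner, and preference makes the element of \<open>T\<close>
  there inner.\<close>

lemma full_neighbour_inner:
  assumes "valid T" "tri s x y" "hard s" "hard x" "hard y" "out x z" "v \<in> T" "v = z \<or> adj z v" "v \<noteq> x"
  shows "inner v"
proof -
  have T: "tri x s y" "tri y s x" using assms(2) tri_sym by blast+
  have H: "heavy E s" "heavy E x" "heavy E y"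
    using hard_tri_heavy[OF assms(2)] hard_tri_heavy[OF T(1)] hard_tri_heavy[OF T(2)] assms(3-5) by blast+
  have "\<not> heavy E z"
    using heavy_neighbours[of x s y z] tri_adj[OF assms(2)] out_adj[OF assms(6)] out_not_tri[OF assms(6) T(1)] H
    by blast
  have Dx: "vdegree E x = 3" "vdegree E z = 3"
    using H(2) out_adj(1)[OF assms(6)] by (auto simp: heavy_def nbrs_adj)
  then obtain p q where pq: "tri z p q" using degree3_tri by blast
  note N = tri_out_nbrs(1)[OF pq out_sym[OF assms(6)]]
  have "\<not> (vdegree E p = 3 \<and> vdegree E q = 3)"
    using heavyI[of z p q x] N Dx(1) tri_adj[OF pq] out_not_tri[OF out_sym[OF assms(6)] pq] \<open>\<not> heavy E z\<close> by blast
  then have "inner p \<or> inner q"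
    using tri_out_nbrs(2) tri_sym[OF pq] unfolding inner_def by blast
  moreover have "v = z \<or> v = p \<or> v = q" using N assms(8,9) by blast
  moreover have "\<not> inner z" using out_sym[OF assms(6)] unfolding inner_def by blast
  ultimately show ?thesis
    using valid_inner[OF assms(1,7)] pq tri_sym[OF pq] by blast
qed

text \<open>Conflicts through \<open>x\<close> and \<open>y\<close> are inner, and so is the element
  \<open>p\<close> facing \<open>s\<close>. Only the vertex beyond \<open>q\<close>, which is
  unique, may fail to be inner.\<close>

lemma card_conflicts_full:
  assumes "valid T" "s \<in> T" "tri s x y" "hard s" "hard x" "hard y"
  shows "card {v \<in> conflicts T s. \<not> inner v} \<le> 1"
proof -
  have T: "tri x s y" "tri y s x" using assms(3) tri_sym by blast+
  obtain z where z: "out s z" "vdegree E z = 3" using assms(4) by (auto simp: hard_def)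
  obtain p q where pq: "tri z p q" "p \<in> T"
  proof -
    obtain p q where "tri z p q" using degree3_tri z(2) by blast
    moreover have "z \<notin> T" using valid_indep[OF assms(1,2)] out_adj[OF z(1)] by blast
    ultimately show ?thesis using that[of p q] that[of q p] valid_hit[OF assms(1)] tri_sym(2) by blast
  qed
  have "p \<noteq> s" using out_not_tri[OF out_sym[OF z(1)] pq(1)] by blast
  then have ip: "inner p"
    using full_neighbour_inner[OF assms(1) T(1) assms(5,4,6) z(1) pq(2)] tri_adj[OF pq(1)] by blast
  have R: "inner v" if "v \<in> T \<inter> reach x \<union> T \<inter> reach y" for v
    using that full_neighbour_inner[OF assms(1,3,4,5,6)] full_neighbour_inner[OF assms(1) tri_sym(2)[OF assms(3)] assms(4,6,5)]
    unfolding reach_def by blast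
  have "out q v" if "v \<in> conflicts T s" "\<not> inner v" for v
  proof -
    have "v \<in> T \<inter> reach2 s"
      using conflicts_exits[OF assms(1-3) hard_not_inner[OF assms(4)]] that R by blast
    then show ?thesis using reach2_hard[OF assms(1,2) z(1) pq _ _ assms(3)] ip that(2) by blast
  qed
  then show ?thesis
    using out_unique[OF tri_sym(3)[OF pq(1)]] by (intro card_le_1I) blast
qed

section \<open>Excluding subsets with all conflict degrees at least 3\<close>

context
  fixes T S
  assumes opt: "optimal T" and ST: "S \<subseteq> T"
    and dense: "\<And>s. s \<in> S \<Longrightarrow> 3 \<le> card {v \<in> S. v \<noteq> s \<and> near s v}"
begin

lemma dense_valid: "valid T"
  using opt by (simp add: optimal_def)

lemma finite_conflicts: "finite (conflicts T s)"
  using valid_finite[OF dense_valid] by (simp add: conflicts_def)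

lemma dense_sub_conflicts: "{v \<in> S. v \<noteq> s \<and> near s v} \<subseteq> conflicts T s"
  using ST by (auto simp: conflicts_def)

lemma dense_card: "s \<in> S \<Longrightarrow> 3 \<le> card (conflicts T s)"
  using dense[of s] card_mono[OF finite_conflicts dense_sub_conflicts, of s] by linarith

lemma dense_not_inner: "s \<in> S \<Longrightarrow> \<not> inner s"
  using dense_card[of s] card_conflicts_inner[OF dense_valid, of s] ST by fastforce

text \<open>A hard element with a soft vertex in its triangle has at most two conflicts. On an
  entirely hard triangle at most one conflict is not inner, while \<open>S\<close> contains no inner
  elements.\<close>

lemma dense_soft:
  assumes "s \<in> S" shows "soft s"
proof (rule ccontr)
  assume ns: "\<not> soft s"
  have sT: "s \<in> T" using assms ST by blast
  obtain x y where xy: "tri s x y" using valid_tri[OF dense_valid sT] by blast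
  have T: "tri s y x" "tri x s y" "tri y s x" using xy tri_sym by blast+
  have h: "hard s" using not_inner_cases[OF xy] dense_not_inner[OF assms] ns by blast
  have "\<not> soft x" "\<not> soft y"
    using card_conflicts_hard[OF opt sT xy h] card_conflicts_hard[OF opt sT T(1) h] dense_card[OF assms] by fastforce+
  then have "hard x" "hard y"
    using valid_not_inner[OF dense_valid sT xy dense_not_inner[OF assms]] not_inner_cases T(2,3) by blast+
  then have "card {v \<in> conflicts T s. \<not> inner v} \<le> 1"
    using card_conflicts_full[OF dense_valid sT xy h] by blast
  moreover have "{v \<in> S. v \<noteq> s \<and> near s v} \<subseteq> {v \<in> conflicts T s. \<not> inner v}"
    using dense_sub_conflicts[of s] dense_not_inner by blast
  ultimately show False
    using dense[OF assms] card_mono[of "{v \<in> conflicts T s. \<not> inner v}" "{v \<in> S. v \<noteq> s \<and> near s v}"]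
      finite_conflicts[of s] by simp
qed

text \<open>Soft elements have at most three conflicts in all of \<open>T\<close>, and three lie in
  \<open>S\<close> already. So \<open>S\<close> is a union of components of the conflict
  graph.\<close>

lemma dense_closed:
  assumes "s \<in> S" "v \<in> conflicts T s" shows "v \<in> S"
proof -
  have "card (conflicts T s) \<le> 3"
    using card_conflicts_soft[OF dense_valid] ST assms(1) dense_soft by blast
  then have "{v \<in> S. v \<noteq> s \<and> near s v} = conflicts T s"
    using card_seteq[OF finite_conflicts dense_sub_conflicts, of s] dense[OF assms(1)] by linarith
  then show ?thesis using assms(2) by blast
qed

text \<open>Three conflicts through three exits with at most one each: every exit shows exactly one
  element, and no element is shown twice.\<close>

lemma dense_exit:
  assumes "s \<in> S" "tri s x y"
  obtains a where "T \<inter> reach x = {a}" "a \<in> S" "a \<notin> reach2 s" "a \<noteq> s"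
proof -
  have sT: "s \<in> T" using assms ST by blast
  have T: "tri x s y" "tri y s x" using assms(2) tri_sym by blast+
  note fin = valid_finite[OF dense_valid]
  note ex = conflicts_exits[OF dense_valid sT assms(2) dense_not_inner[OF assms(1)]]
  have c: "card (T \<inter> reach x) \<le> 1" "card (T \<inter> reach y) \<le> 1" "card (T \<inter> reach2 s) \<le> 1"
    using card_reach[OF dense_valid] card_reach2_soft[OF dense_valid assms(2) dense_soft[OF assms(1)]] T by blast+
  have n: "\<not> T \<inter> reach x \<subseteq> T \<inter> reach2 s"
  proof
    assume "T \<inter> reach x \<subseteq> T \<inter> reach2 s"
    then have "conflicts T s \<subseteq> T \<inter> reach2 s \<union> T \<inter> reach y" using ex by blast
    then have "card (conflicts T s) \<le> 2"
      using card_subset_Un2[of "T \<inter> reach2 s" "T \<inter> reach y" "conflicts T s"] fin c by simp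
    then show False using dense_card[OF assms(1)] by simp
  qed
  then obtain a where a: "a \<in> T" "a \<in> reach x" "a \<notin> reach2 s" by blast
  then have "T \<inter> reach x = {a}"
    using c(1) fin card_le_Suc0_iff_eq[of "T \<inter> reach x"] by auto
  moreover obtain z where z: "out x z" "a = z \<or> adj z a" using a(2) unfolding reach_def by blast
  moreover have "a \<noteq> s"
    using z out_not_tri[OF z(1) T(1)] tri_adj[OF assms(2)] unfolding out_def by (metis adj_sym)
  moreover have "near s a" using z tri_adj(1)[OF assms(2)] out_adj(1)[OF z(1)] unfolding near_def by blast
  then have "a \<in> S" using dense_closed[OF assms(1)] a(1) \<open>a \<noteq> s\<close> by (simp add: conflicts_def)
  ultimately show ?thesis using that a(3) by blast
qed

text \<open>Two hard elements of \<open>S\<close> are excluded: \<open>z\<close> itself, since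
  \<open>x\<close> has degree 3, and any \<open>v\<close> in \<open>T\<close> beyond
  \<open>q\<close>, since it is near \<open>a\<close> and \<open>q\<close> has degree 3.\<close>

lemma dense_hard_exit:
  assumes "s \<in> S" "tri s x y" "out x z" "vdegree E z = 3"
  obtains a q where "tri z a q" "a \<in> S" "z \<notin> T" "a \<notin> reach2 s" "a \<noteq> s" "\<And>v. out q v \<Longrightarrow> v \<notin> T"
proof -
  have T: "tri x s y" using assms(2) tri_sym by blast
  obtain a where a: "T \<inter> reach x = {a}" "a \<in> S" "a \<notin> reach2 s" "a \<noteq> s" using dense_exit[OF assms(1,2)] .
  obtain p q where pq: "tri z p q" using degree3_tri assms(4) by blast
  have Dx: "vdegree E x = 3" using tri_out_nbrs(2)[OF T assms(3)] .
  have zS: "z \<notin> S"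
    using dense_soft soft_hard_disjoint[OF pq] out_sym[OF assms(3)] Dx unfolding hard_def by blast
  have az: "a = z \<or> adj z a" "a \<noteq> x"
    using a(1) out_unique[OF T assms(3)] unfolding reach_def by blast+
  then have za: "adj z a" using zS a(2) by blast
  have zT: "z \<notin> T" using valid_indep[OF dense_valid] za a(2) ST by blast
  obtain r where r: "tri z a r"
    using tri_out_nbrs(1)[OF pq out_sym[OF assms(3)], of a] za az(2) pq tri_sym(2)[OF pq] by blast
  have "v \<notin> T" if v: "out r v" for v
  proof
    assume vT: "v \<in> T"
    have "near a v" using tri_adj[OF r] out_adj[OF v] unfolding near_def by blast
    moreover have "v \<noteq> a" using out_not_tri[OF v tri_sym(3)[OF r]] by blast
    ultimately have vS: "v \<in> S" using dense_closed[OF a(2)] vT by (simp add: conflicts_def)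
    have "vdegree E r = 3" using tri_out_nbrs(2)[OF tri_sym(3)[OF r] v] .
    then have "hard v" using out_sym[OF v] unfolding hard_def by blast
    then show False using dense_soft[OF vS] soft_hard_disjoint valid_tri[OF dense_valid vT] by blast
  qed
  then show ?thesis using that r a zT by blast
qed

text \<open>The incoming \<open>x\<close> may be hard, yet its exit shows at most one element: the
  second candidate of \<open>reach2_hard\<close>, beyond \<open>q\<close>, has just been
  excluded.\<close>

lemma dense_swap:
  assumes "s \<in> S" "tri s x y" "out x z"
  shows "valid (swap T s x)" "z \<notin> T"
    "card (swap T s x \<inter> reach2 x) \<le> 1"
proof -
  let ?T = "swap T s x"
  have sT: "s \<in> T" using assms ST by blast
  have T: "tri x s y" using assms(2) tri_sym by blast
  show zT: "z \<notin> T"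
  proof (cases "vdegree E z = 3")
    case True
    then show ?thesis using dense_hard_exit[OF assms] by blast
  qed (use low_degree_not_mem[OF dense_valid assms(3)] in blast)
  show v: "valid ?T"
    using valid_swap[OF dense_valid sT assms(2) dense_not_inner[OF assms(1)] assms(3) zT] .
  show "card (?T \<inter> reach2 x) \<le> 1"
  proof (cases "vdegree E z = 3")
    case True
    obtain a q where aq: "tri z a q" "a \<in> S" "z \<notin> T" "a \<notin> reach2 s" "a \<noteq> s" "\<And>v. out q v \<Longrightarrow> v \<notin> T"
      using dense_hard_exit[OF assms True] by metis
    have aT: "a \<in> ?T" "x \<in> ?T" using aq ST by (auto simp: swap_def)
    have "v = a" if "v \<in> ?T \<inter> reach2 x" for v
      using reach2_hard[OF v aT(2) assms(3) aq(1) aT(1) _ _ T, of v] that aq(6)[of v]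
      by (auto simp: swap_def reach2_def)
    then show ?thesis by (intro card_le_1I) blast
  next
    case False
    then have "soft x" using assms(3) unfolding soft_def by blast
    then show ?thesis using card_reach2_soft[OF v T] by blast
  qed
qed

lemma dense_swap_card:
  assumes "s \<in> S" "tri s x y" "out x z"
  shows "card (conflicts (swap T s x) x) \<le> 2 + card (swap T s x \<inter> reach s)"
proof -
  let ?T = "swap T s x"
  have T: "tri x s y" "tri y s x" using assms(2) tri_sym by blast+
  have "x \<in> ?T" "\<not> inner x" using assms(3) by (auto simp: swap_def inner_def)
  then show ?thesis
    using card_conflicts_le[OF dense_swap(1)[OF assms] _ T(1)] card_reach[OF dense_swap(1)[OF assms] T(2)]
      dense_swap(3)[OF assms] by fastforce
qed

lemma dense_out:
  assumes "s \<in> S" "tri s x y"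
  obtains z where "out x z"
  using not_inner_out[OF tri_sym(1)[OF assms(2)]] assms ST
    valid_not_inner[OF dense_valid _ assms(2) dense_not_inner[OF assms(1)]] by blast

text \<open>By optimality the exchange of \<open>s\<close> for \<open>x\<close> leaves at least
  three conflicts. The exit of \<open>s\<close> must therefore still show an element, which lies
  beyond the vertex \<open>z\<close> of degree 2.\<close>

lemma dense_link:
  assumes "s \<in> S" "out s z"
  obtains u where "u \<in> S" "u \<noteq> s" "adj z u" "vdegree E z \<noteq> 3"
proof -
  have sT: "s \<in> T" using assms ST by blast
  obtain x y where xy: "tri s x y" using valid_tri[OF dense_valid sT] by blast
  obtain zx where zx: "out x zx" using dense_out[OF assms(1) xy] .
  let ?T = "swap T s x"
  have Dz: "vdegree E z \<noteq> 3"
    using dense_soft[OF assms(1)] out_unique[OF xy assms(2)] unfolding soft_def by blast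
  have "3 \<le> card (conflicts ?T x)"
    using optimal_swap[OF opt sT xy dense_not_inner[OF assms(1)] zx dense_swap(2)[OF assms(1) xy zx]]
      dense_card[OF assms(1)] by linarith
  then have "1 \<le> card (?T \<inter> reach s)" using dense_swap_card[OF assms(1) xy zx] by linarith
  then obtain u where u: "u \<in> ?T" "u \<in> reach s" by (metis card.empty not_one_le_zero IntE ex_in_conv)
  have us: "u \<noteq> s" "u = z \<or> adj z u" using u(2) out_unique[OF xy assms(2)] unfolding reach_def by blast+
  have "z \<notin> ?T" using low_degree_not_mem[OF dense_swap(1)[OF assms(1) xy zx] assms(2) Dz] .
  then have zu: "adj z u" using us(2) u(1) by blast
  have "u \<noteq> x" using zu assms(2) tri_adj(1)[OF xy] unfolding out_def by (metis)
  then have "u \<in> T" using u(1) by (simp add: swap_def)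
  moreover have "near s u" using zu out_adj(1)[OF assms(2)] unfolding near_def by blast
  ultimately have "u \<in> S" using dense_closed[OF assms(1)] us(1) by (simp add: conflicts_def)
  then show ?thesis using that us(1) zu Dz by blast
qed

text \<open>If \<open>z\<close> had degree 2, its neighbours would be \<open>x\<close> and the
  element \<open>a\<close> of \<open>S\<close> seen through it. Linking \<open>a\<close> across
  \<open>z\<close> then requires an element of \<open>S\<close> at \<open>x\<close>.\<close>

lemma dense_hard:
  assumes "s \<in> S" "tri s x y" "out x z"
  shows "vdegree E z = 3"
proof (rule ccontr)
  assume D: "vdegree E z \<noteq> 3"
  have T: "tri x s y" using assms(2) tri_sym by blast
  obtain a where a: "T \<inter> reach x = {a}" "a \<in> S" using dense_exit[OF assms(1,2)] .
  have az: "a = z \<or> adj z a" "a \<noteq> x" using a(1) out_unique[OF T assms(3)] unfolding reach_def by blast+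
  have "z \<notin> T" using low_degree_not_mem[OF dense_valid assms(3) D] .
  then have za: "adj z a" using az(1) a(2) ST by blast
  have "out a z" using za low_degree_not_tri[OF assms(3) D] adj_sym unfolding out_def tri_def by blast
  then obtain u where u: "u \<in> S" "u \<noteq> a" "adj z u" using dense_link[OF a(2)] by blast
  have "x \<notin> T" using valid_indep[OF dense_valid] assms(1) ST tri_adj(1)[OF assms(2)] by blast
  then have "u \<noteq> x" using u(1) ST by blast
  then show False using degree3I[of z x a u] D u za az(2) out_adj(2)[OF assms(3)] by blast
qed

text \<open>Here \<open>w\<close> stands for a vertex brought in by an earlier exchange; it must not
  lie beyond \<open>q\<close>. If it did for both candidates \<open>a\<close> and \<open>b\<close>,
  their exits would lead to the same triangle and the same vertex of it, so
  \<open>a = b\<close>.\<close>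

lemma dense_second_exit:
  assumes "u \<in> S" "tri u a b" "tri w c d"
  obtains x y z p q where "tri u x y" "out x z" "tri z p q" "p \<in> S" "z \<notin> T" "p \<notin> reach2 u" "p \<noteq> u"
    "\<And>v. out q v \<Longrightarrow> v \<notin> T \<and> v \<noteq> w"
proof -
  have T: "tri u b a" "tri a u b" "tri b u a" using assms(2) tri_sym by blast+
  obtain z where z: "out a z" using dense_out[OF assms(1,2)] .
  obtain z' where z': "out b z'" using dense_out[OF assms(1) T(1)] .
  obtain p q where pq: "tri z p q" "p \<in> S" "z \<notin> T" "p \<notin> reach2 u" "p \<noteq> u" "\<And>v. out q v \<Longrightarrow> v \<notin> T"
    using dense_hard_exit[OF assms(1,2) z dense_hard[OF assms(1,2) z]] by metis
  obtain p' q' where pq': "tri z' p' q'" "p' \<in> S" "z' \<notin> T" "p' \<notin> reach2 u" "p' \<noteq> u" "\<And>v. out q' v \<Longrightarrow> v \<notin> T"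
    using dense_hard_exit[OF assms(1) T(1) z' dense_hard[OF assms(1) T(1) z']] by metis
  show ?thesis
  proof (cases "out q w \<and> out q' w")
    case False
    then show ?thesis
    proof (cases "out q w")
      case True
      then show ?thesis using that[OF T(1) z' pq'(1-5)] pq'(6) False by blast
    next
      case nq: False
      then show ?thesis using that[OF assms(2) z pq(1-5)] pq(6) by blast
    qed
  next
    case True
    then have "q = q'" using out_unique[OF assms(3)] out_sym by blast
    have nc: "\<not> center q" using True center_not_out by blast
    have "{z', p'} = {z, p}"
      using not_center_tri_unique[OF nc tri_sym(5)[OF pq(1)]] tri_sym(5)[OF pq'(1)] \<open>q = q'\<close> by blast
    then have "z = z'" using pq(2,3) pq'(2,3) ST by (metis doubleton_eq_iff subsetD)
    then have "a = b" using out_unique[OF pq(1)] out_sym[OF z] out_sym[OF z'] by blast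
    then show ?thesis using tri_adj(8)[OF assms(2)] by blast
  qed
qed

text \<open>Exchanging \<open>s\<close> for \<open>x\<close> does not increase the conflict pairs.
  Then \<open>z\<close> has no element of \<open>T\<close> left besides \<open>u\<close>, so
  exchanging \<open>u\<close>, which still has three conflicts, brings in a vertex with at most two:
  a strict decrease.\<close>

lemma dense_empty: "S = {}"
proof (rule ccontr)
  assume "S \<noteq> {}"
  then obtain s where s: "s \<in> S" by blast
  have sT: "s \<in> T" using s ST by blast
  obtain x y where xy: "tri s x y" using valid_tri[OF dense_valid sT] by blast
  have X: "tri x s y" using xy tri_sym by blast
  obtain zx where zx: "out x zx" using dense_out[OF s xy] .
  obtain z where z: "out s z" using not_inner_out[OF xy dense_not_inner[OF s]] by blast
  obtain u where u: "u \<in> S" "u \<noteq> s" "adj z u" "vdegree E z \<noteq> 3" using dense_link[OF s z] .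
  have uT: "u \<in> T" using u ST by blast
  have uz: "out u z" using u(3) low_degree_not_tri[OF z u(4)] adj_sym unfolding out_def tri_def by blast
  obtain c d where cd: "tri u c d" using valid_tri[OF dense_valid uT] by blast
  obtain x2 y2 z2 p q where U: "tri u x2 y2" "out x2 z2" "tri z2 p q" "p \<in> S" "z2 \<notin> T" "p \<notin> reach2 u" "p \<noteq> u"
    "\<And>v. out q v \<Longrightarrow> v \<notin> T \<and> v \<noteq> x"
    using dense_second_exit[OF u(1) cd X] by metis
  have X2: "tri x2 u y2" "tri y2 u x2" using U(1) tri_sym by blast+
  let ?T1 = "swap T s x"
  let ?T2 = "swap ?T1 u x2"
  have v1: "valid ?T1" using dense_swap(1)[OF s xy zx] .
  have xT: "x \<notin> T" using valid_indep[OF dense_valid sT] tri_adj(1)[OF xy] by blast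
  have x2T: "x2 \<notin> T" using valid_indep[OF dense_valid uT] tri_adj(1)[OF U(1)] by blast
  have ux: "u \<noteq> x" using xT uT by blast
  have uT1: "u \<in> ?T1" using uT u(2) by (simp add: swap_def)
  have us: "u \<in> reach2 s" using u(2,3) z unfolding reach2_def by blast
  have su: "s \<in> reach2 u" using u(2) out_adj(2)[OF z] uz unfolding reach2_def by blast
  \<comment> \<open>Otherwise \<open>s\<close> would see \<open>u\<close> through two exits.\<close>
  have nx2: "z2 \<noteq> x"
  proof
    assume "z2 = x"
    then have "u \<in> reach x" using out_sym[OF U(2)] tri_adj(2)[OF U(1)] ux unfolding reach_def by blast
    then show False using dense_exit[OF s xy] us uT by (metis IntI singletonD)
  qed
  have z2T1: "z2 \<notin> ?T1" using U(5) nx2 by (simp add: swap_def)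
  have v2: "valid ?T2" using valid_swap[OF v1 uT1 U(1) dense_not_inner[OF u(1)] U(2) z2T1] .
  have "p \<noteq> s" using U(6) su by blast
  then have pT2: "p \<in> ?T2" "x2 \<in> ?T2" using U(4,7) ST by (auto simp: swap_def)
  have "v = p" if "v \<in> ?T2 \<inter> reach2 x2" for v
    using reach2_hard[OF v2 pT2(2) U(2,3) pT2(1) _ _ X2(1), of v] that U(8)[of v]
    by (auto simp: swap_def reach2_def)
  then have r2: "card (?T2 \<inter> reach2 x2) \<le> 1" by (intro card_le_1I) blast
  have "?T2 \<inter> reach u = {}"
  proof (rule ccontr)
    assume "?T2 \<inter> reach u \<noteq> {}"
    then obtain v where v: "v \<in> ?T2" "v \<in> reach u" by blast
    have vu: "v \<noteq> u" "v = z \<or> adj z v" using v(2) out_unique[OF cd uz] unfolding reach_def by blast+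
    then have zv: "adj z v" using low_degree_not_mem[OF v2 uz u(4)] v(1) by blast
    then have "v = s" using degree3I[of z s u v] u vu(1) out_adj(2)[OF z] by blast
    then have "s = x2" using v(1) tri_adj(7)[OF xy] by (auto simp: swap_def)
    then show False using sT x2T by blast
  qed
  then have c2: "card (conflicts ?T2 x2) \<le> 2"
    using card_conflicts_le[OF v2 pT2(2) X2(1)] r2 card_reach[OF v2 X2(2)] U(2) unfolding inner_def by fastforce
  have nxs: "near u x"
    using u(3) adj_sym out_adj[OF z] tri_adj(1)[OF xy] unfolding near_def by blast
  have fT1: "finite ?T1" using valid_finite[OF v1] .
  have x2T1: "x2 \<notin> ?T1"
  proof -
    have "x2 \<noteq> x"
      using nxs \<open>?T2 \<inter> reach u = {}\<close> uT1 valid_indep[OF v1 uT1] tri_adj(1)[OF U(1)] by (auto simp: swap_def)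
    then show ?thesis using x2T by (simp add: swap_def)
  qed
  \<comment> \<open>The conflict of \<open>u\<close> with \<open>s\<close> is replaced by one with
    \<open>x\<close>, owing to the walk \<open>u\<close>, \<open>z\<close>, \<open>s\<close>,
    \<open>x\<close>.\<close>
  have "3 \<le> card (conflicts ?T1 u)"
  proof -
    have "s \<in> conflicts T u" using sT u(2,3) adj_sym out_adj[OF z] unfolding conflicts_def near_def by blast
    moreover have "conflicts ?T1 u = insert x (conflicts T u - {s})"
      using nxs ux by (auto simp: conflicts_def swap_def)
    moreover have "x \<notin> conflicts T u" using xT by (simp add: conflicts_def)
    ultimately have "card (conflicts ?T1 u) = card (conflicts T u)"
      using finite_conflicts[of u] dense_card[OF u(1)] by simp
    then show ?thesis using dense_card[OF u(1)] by simp
  qed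
  moreover have "card (conflict_pairs ?T2) + card (conflicts ?T1 u) =
      card (conflict_pairs ?T1) + card (conflicts ?T2 x2)"
    using card_conflict_pairs_swap[OF fT1 uT1 x2T1] .
  moreover have "card (conflict_pairs ?T1) + card (conflicts T s) =
      card (conflict_pairs T) + card (conflicts ?T1 x)"
    using card_conflict_pairs_swap[OF valid_finite[OF dense_valid] sT xT] .
  moreover have "card (conflicts ?T1 x) \<le> 3"
    using dense_swap_card[OF s xy zx] card_reach[OF v1 xy] by linarith
  moreover have "card (conflict_pairs T) \<le> card (conflict_pairs ?T2)"
    using opt v2 unfolding optimal_def by blast
  ultimately show False using c2 dense_card[OF s] by linarith
qed

end

lemma optimal_colorable:
  assumes "optimal T"
  shows "\<exists>c::'a \<Rightarrow> nat. \<forall>x\<in>T. c x \<le> 2 \<and> (\<forall>y\<in>T. x \<noteq> y \<longrightarrow> near x y \<longrightarrow> c x \<noteq> c y)"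
proof (rule degenerate_colorable)
  show "finite T" using assms valid_finite by (simp add: optimal_def)
  show "near y x" if "near x y" for x y using near_sym[OF that] .
  show "\<exists>s\<in>S. card {x \<in> S. x \<noteq> s \<and> near s x} \<le> 2" if S: "S \<subseteq> T" "S \<noteq> {}" for S
  proof (rule ccontr)
    assume "\<not> ?thesis"
    then have "3 \<le> card {x \<in> S. x \<noteq> s \<and> near s x}" if "s \<in> S" for s using that by fastforce
    then show False using dense_empty[OF assms S(1)] S(2) by blast
  qed
qed

section \<open>The graph outside the transversal\<close>

definition rest :: "'a set \<Rightarrow> 'a \<Rightarrow> 'a \<Rightarrow> bool" where
  "rest T x y \<longleftrightarrow> adj x y \<and> x \<notin> T \<and> y \<notin> T"

definition thick :: "'a set \<Rightarrow> 'a \<Rightarrow> bool" where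
  "thick T v \<longleftrightarrow> v \<notin> T \<and> 2 \<le> card {u. rest T v u}"

text \<open>All degrees in the component are at least 2; for valid \<open>T\<close> they are also at
  most 2, so the component is a cycle, captured here without listing its vertices.\<close>

definition in_cycle :: "'a set \<Rightarrow> 'a \<Rightarrow> bool" where
  "in_cycle T v \<longleftrightarrow> (\<forall>y. (rest T)\<^sup>*\<^sup>* v y \<longrightarrow> thick T y)"

text \<open>On a cycle these are the vertices of degree 2, which have no neighbour in
  \<open>T\<close>, and the tips of diamonds, whose neighbour in \<open>T\<close> has all its
  neighbours on the same cycle.\<close>

definition removable :: "'a set \<Rightarrow> 'a \<Rightarrow> bool" where
  "removable T w \<longleftrightarrow> vdegree E w \<noteq> 3 \<or> (\<not> center w \<and> (\<exists>b. center b \<and> rest T w b))"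

lemma rest_sym: "rest T x y \<Longrightarrow> rest T y x"
  by (auto simp: rest_def intro: adj_sym)

lemma rest_rtranclp_sym: "(rest T)\<^sup>*\<^sup>* x y \<Longrightarrow> (rest T)\<^sup>*\<^sup>* y x"
  by (induction rule: rtranclp_induct) (auto intro: converse_rtranclp_into_rtranclp rest_sym)

lemma finite_rest: "finite {u. rest T v u}"
  by (rule finite_subset[OF _ finite_nbrs[of v]]) (auto simp: rest_def)

lemma in_cycle_thick: "in_cycle T v \<Longrightarrow> thick T v"
  unfolding in_cycle_def by blast

lemma in_cycle_rest: "in_cycle T v \<Longrightarrow> rest T v u \<Longrightarrow> in_cycle T u"
  unfolding in_cycle_def by (meson converse_rtranclp_into_rtranclp)

lemma in_cycle_rtranclp: "in_cycle T v \<Longrightarrow> (rest T)\<^sup>*\<^sup>* v u \<Longrightarrow> in_cycle T u"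
  unfolding in_cycle_def by (meson rtranclp_trans)

text \<open>A vertex of degree 3 loses a neighbour to \<open>T\<close>, which hits its
  triangle.\<close>

lemma card_rest_le:
  assumes "valid T" "v \<notin> T"
  shows "card {u. rest T v u} \<le> 2"
proof (cases "vdegree E v = 3")
  case True
  then obtain x y where xy: "tri v x y" using degree3_tri by blast
  then obtain t where t: "t \<in> T" "adj v t" using valid_hit[OF assms(1) xy] assms(2) tri_adj[OF xy] by blast
  then have "{u. rest T v u} \<subset> {u. adj v u}" by (auto simp: rest_def)
  then have "card {u. rest T v u} < card {u. adj v u}" by (intro psubset_card_mono finite_nbrs)
  then show ?thesis using vdegree_le[of v] by simp
next
  case False
  then have "card {u. adj v u} \<le> 2" using vdegree_le[of v] by (simp add: vdegree_def nbrs_adj)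
  moreover have "card {u. rest T v u} \<le> card {u. adj v u}"
    by (intro card_mono finite_nbrs) (auto simp: rest_def)
  ultimately show ?thesis by linarith
qed

lemma thickE:
  assumes "thick T v"
  obtains a b where "rest T v a" "rest T v b" "a \<noteq> b"
proof -
  have "\<exists>a\<in>{u. rest T v u}. \<exists>b\<in>{u. rest T v u}. a \<noteq> b"
    using assms card_le_Suc0_iff_eq[OF finite_rest[of T v]] unfolding thick_def by fastforce
  then show ?thesis using that by blast
qed

lemma thick_unique:
  assumes "thick T v" "adj v s" "adj v s'" "s \<in> T" "s' \<in> T"
  shows "s = s'"
proof -
  obtain a b where "rest T v a" "rest T v b" "a \<noteq> b" using thickE[OF assms(1)] .
  then show ?thesis using nbr_cases[of v a b s s'] assms unfolding rest_def by blast
qed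

lemma thick_low_degree:
  assumes "thick T v" "adj v s" "vdegree E v \<noteq> 3"
  shows "s \<notin> T"
proof -
  obtain a b where "rest T v a" "rest T v b" "a \<noteq> b" using thickE[OF assms(1)] .
  then show ?thesis using degree3I[of v a b s] assms unfolding rest_def by blast
qed

text \<open>If \<open>a\<close> has a neighbour \<open>t\<close> in \<open>T\<close>, the cycle
  continues to the third vertex of their triangle, whose only neighbour in \<open>T\<close> is again
  \<open>t\<close>. Otherwise \<open>a\<close> has degree 2, and the next vertex of the cycle has at
  most one neighbour in \<open>T\<close>.\<close>

lemma in_cycle_exit_unique:
  assumes "valid T" "in_cycle T w" "out w a" "a \<notin> T" "s \<in> T" "s' \<in> T"
    and "adj a s \<or> (\<exists>u. u \<noteq> w \<and> adj a u \<and> adj u s)" "adj a s' \<or> (\<exists>u. u \<noteq> w \<and> adj a u \<and> adj u s')"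
  shows "s = s'"
proof -
  have wT: "w \<notin> T" using in_cycle_thick[OF assms(2)] by (simp add: thick_def)
  have ra: "in_cycle T a" using in_cycle_rest[OF assms(2)] out_adj(1)[OF assms(3)] wT assms(4) by (simp add: rest_def)
  show ?thesis
  proof (cases "\<exists>t\<in>T. adj a t")
    case True
    then obtain t where t: "t \<in> T" "adj a t" by blast
    have "vdegree E a = 3" using thick_low_degree[OF in_cycle_thick[OF ra] t(2)] t(1) by blast
    then obtain x y where xy: "tri a x y" using degree3_tri by blast
    then have "x \<in> T \<or> y \<in> T" using valid_hit[OF assms(1)] assms(4) by blast
    then have "x = t \<or> y = t" using thick_unique[OF in_cycle_thick[OF ra] _ t(2) _ t(1)] tri_adj[OF xy] by blast
    then obtain p where p: "tri a t p" using xy tri_sym(2) by blast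
    have N: "adj a u \<longleftrightarrow> u = t \<or> u = p \<or> u = w" for u using tri_out_nbrs(1)[OF p out_sym[OF assms(3)]] .
    have pT: "p \<notin> T" using valid_indep[OF assms(1) t(1)] tri_adj[OF p] by blast
    have rp: "in_cycle T p" using in_cycle_rest[OF ra] tri_adj(5)[OF p] pT assms(4) by (simp add: rest_def)
    have "v = t" if "v \<in> T" "adj a v \<or> (\<exists>u. u \<noteq> w \<and> adj a u \<and> adj u v)" for v
    proof -
      have "v = t \<or> adj t v \<or> adj p v" using that N wT pT by auto
      then show ?thesis
        using valid_indep[OF assms(1) t(1) that(1)] thick_unique[OF in_cycle_thick[OF rp] _ tri_adj(4)[OF p] that(1) t(1)]
        by blast
    qed
    then show ?thesis using assms(5-8) by blast
  next
    case False
    have Da: "vdegree E a \<noteq> 3"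
    proof
      assume "vdegree E a = 3"
      then obtain x y where xy: "tri a x y" using degree3_tri by blast
      then show False using valid_hit[OF assms(1) xy] False assms(4) tri_adj[OF xy] by blast
    qed
    obtain u where u: "u \<noteq> w" "adj a u" "adj u s" using assms(5,7) False by blast
    obtain u' where u': "u' \<noteq> w" "adj a u'" "adj u' s'" using assms(6,8) False by blast
    have "u = u'" using degree3I[of a w u u'] u u' Da out_adj(2)[OF assms(3)] by blast
    moreover have "in_cycle T u" using in_cycle_rest[OF ra] u(2) False assms(4) by (auto simp: rest_def)
    ultimately show ?thesis using thick_unique[OF in_cycle_thick] u u' assms(5,6) by blast
  qed
qed

lemma center_mem:
  assumes "valid T" "center b" "b \<notin> T"
  obtains t y z where "t \<in> T" "tri b t y" "tri b t z" "y \<noteq> z"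
proof -
  obtain x y z where D: "tri b x y" "tri b x z" "y \<noteq> z" using assms(2) unfolding center_def by blast
  note C = center_diamond[OF D]
  have "x \<in> T" if "y \<in> T"
    using valid_center[OF assms(1) that tri_sym(5)[OF D(1)] assms(2)] C(5) by blast
  then have "x \<in> T" using valid_hit[OF assms(1) D(1)] assms(3) by blast
  then show ?thesis using that D by blast
qed

text \<open>Preference puts the other centre \<open>t\<close> into \<open>T\<close>, so the cycle
  passes through \<open>b\<close> from tip to tip.\<close>

lemma removable_diamond:
  assumes "valid T" "in_cycle T w" "\<not> center w" "center b" "rest T w b"
  obtains t v z where "t \<in> T" "tri b t w" "tri b t v" "w \<noteq> v" "out w z" "z \<notin> T" "in_cycle T v"
    "rest T b v"
proof -
  have bw: "adj w b" "b \<notin> T" "w \<notin> T" using assms(5) by (auto simp: rest_def)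
  obtain t y y' where D: "t \<in> T" "tri b t y" "tri b t y'" "y \<noteq> y'"
    using center_mem[OF assms(1,4) bw(2)] .
  have "w = y \<or> w = y'" using center_diamond(1)[OF D(2-4), of w] adj_sym[OF bw(1)] bw(3) D(1) by blast
  then obtain v where v: "tri b t w" "tri b t v" "w \<noteq> v" using D by metis
  have W: "tri w b t" using v(1) tri_sym by blast
  obtain z where z: "rest T w z" "z \<noteq> b" using thickE[OF in_cycle_thick[OF assms(2)]] by metis
  then have zo: "out w z" "z \<notin> T"
    using not_center_nbr[OF assms(3) W, of z] D(1) unfolding rest_def by blast+
  have vT: "v \<notin> T" using valid_indep[OF assms(1) D(1)] tri_adj[OF v(2)] by blast
  have bv: "rest T b v" using bw(2) vT tri_adj(5)[OF v(2)] by (simp add: rest_def)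
  have "in_cycle T v" using in_cycle_rest[OF in_cycle_rest[OF assms(2,5)] bv] .
  then show ?thesis using that D(1) v zo bv by blast
qed

text \<open>A walk of length 3 that returns to \<open>w\<close> would end with the excluded edge
  from \<open>w\<close> to \<open>s\<close>; hence \<open>u \<noteq> w\<close>.\<close>

lemma near_step:
  assumes "near w s" "s \<noteq> w" "\<not> adj w s"
  shows "\<exists>c. adj w c \<and> (adj c s \<or> (\<exists>u. u \<noteq> w \<and> adj c u \<and> adj u s))"
proof -
  consider a where "adj w a" "adj a s" | a b where "adj w a" "adj a b" "adj b s"
    using assms unfolding near_def by blast
  then show ?thesis using assms(3) by cases metis+
qed

text \<open>A vertex of degree 2 has two outgoing edges showing at most one element each. A tip sees
  the centre \<open>t\<close> and at most one element through its exit, since detours inside the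
  diamond lead only to \<open>t\<close>.\<close>

lemma removable_card:
  assumes "valid T" "in_cycle T w" "removable T w"
  shows "card (conflicts T w) \<le> 2"
proof -
  let ?D = "\<lambda>a. {s \<in> T. adj a s \<or> (\<exists>u. u \<noteq> w \<and> adj a u \<and> adj u s)}"
  note fin = valid_finite[OF assms(1)]
  have wT: "w \<notin> T" using in_cycle_thick[OF assms(2)] by (simp add: thick_def)
  have D: "card (?D a) \<le> 1" if "out w a" "a \<notin> T" for a
    by (rule card_le_1I) (use in_cycle_exit_unique[OF assms(1,2) that] in blast)
  show ?thesis
  proof (cases "vdegree E w = 3")
    case False
    have nT: "a \<notin> T" if "adj w a" for a using thick_low_degree[OF in_cycle_thick[OF assms(2)] that False] .
    have o: "out w a" if a: "adj w a" for a
    proof (rule ccontr)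
      assume "\<not> out w a"
      then obtain c where "tri w a c" using a unfolding out_def tri_def by blast
      then show False using valid_hit[OF assms(1)] wT nT tri_adj by blast
    qed
    obtain a b where ab: "rest T w a" "rest T w b" "a \<noteq> b" using thickE[OF in_cycle_thick[OF assms(2)]] .
    have N: "u = a \<or> u = b" if "adj w u" for u
      using degree3I[of w a b u] that ab False unfolding rest_def by blast
    have "conflicts T w \<subseteq> ?D a \<union> ?D b"
    proof
      fix s assume "s \<in> conflicts T w"
      then have s: "s \<in> T" "s \<noteq> w" "near w s" by (auto simp: conflicts_def)
      have "\<not> adj w s" using nT s(1) by blast
      then obtain c where "adj w c" "adj c s \<or> (\<exists>u. u \<noteq> w \<and> adj c u \<and> adj u s)"
        using near_step[OF s(3,2)] by blast
      then show "s \<in> ?D a \<union> ?D b" using N s(1) by blast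
    qed
    then have "card (conflicts T w) \<le> card (?D a) + card (?D b)"
      using fin by (intro card_subset_Un2) simp_all
    moreover have "card (?D a) \<le> 1" "card (?D b) \<le> 1"
      using D o ab nT unfolding rest_def by blast+
    ultimately show ?thesis by linarith
  next
    case True
    then obtain b where b: "\<not> center w" "center b" "rest T w b" using assms(3) by (auto simp: removable_def)
    obtain t v z where tv: "t \<in> T" "tri b t w" "tri b t v" "w \<noteq> v" "out w z" "z \<notin> T" "in_cycle T v"
      using removable_diamond[OF assms(1,2) b] .
    have bT: "b \<notin> T" using b(3) by (simp add: rest_def)
    have vT: "v \<notin> T" using in_cycle_thick[OF tv(7)] by (simp add: thick_def)
    have Nw: "adj w u \<longleftrightarrow> u = b \<or> u = t \<or> u = z" for u
      using tri_out_nbrs(1)[OF tri_sym(5)[OF tv(2)] tv(5)] .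
    have Nb: "adj b u \<longleftrightarrow> u = t \<or> u = w \<or> u = v" for u using center_diamond(1)[OF tv(2-4)] .
    have Nt: "adj t u \<longleftrightarrow> u = b \<or> u = w \<or> u = v" for u using center_diamond(2)[OF tv(2-4)] .
    have Tw: "s = t" if "s \<in> T" "adj w s" for s using that Nw[of s] bT tv(6) by blast
    have Tb: "s = t" if "s \<in> T" "adj b s" for s using that Nb[of s] wT vT by blast
    have Tv: "s = t" if "s \<in> T" "adj v s" for s
      using thick_unique[OF in_cycle_thick[OF tv(7)] that(2) _ that(1) tv(1)] tri_adj[OF tv(3)] by blast
    have Tt: False if "s \<in> T" "adj t s" for s using valid_indep[OF assms(1) tv(1) that(1)] that(2) by blast
    have "conflicts T w \<subseteq> {t} \<union> ?D z"
    proof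
      fix s assume "s \<in> conflicts T w"
      then have s: "s \<in> T" "s \<noteq> w" "near w s" by (auto simp: conflicts_def)
      show "s \<in> {t} \<union> ?D z"
      proof (cases "s = t")
        case ne: False
        then have n: "\<not> adj w s" "\<not> adj b s" "\<not> adj v s" "\<not> adj t s"
          using Tw Tb Tv Tt s(1) by blast+
        then obtain c where c: "adj w c" "adj c s \<or> (\<exists>u. u \<noteq> w \<and> adj c u \<and> adj u s)"
          using near_step[OF s(3,2)] by blast
        have "c \<noteq> b" "c \<noteq> t" using c(2) Nb Nt n by auto
        then have "c = z" using Nw[of c] c(1) by blast
        then show ?thesis using c(2) s(1) by blast
      qed simp
    qed
    then have "card (conflicts T w) \<le> card {t} + card (?D z)"
      using fin by (intro card_subset_Un2) simp_all
    then show ?thesis using D[OF tv(5,6)] by simp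
  qed
qed

text \<open>Such an \<open>s\<close> is the centre of a diamond whose other three vertices are
  consecutive on the cycle of \<open>w\<close>. A short walk from \<open>w\<close> thus cannot
  change components by passing through \<open>s\<close>.\<close>

lemma removable_closed:
  assumes "valid T" "in_cycle T w" "removable T w" "s \<in> T" "adj w s" "adj s u"
  shows "(rest T)\<^sup>*\<^sup>* w u"
proof -
  have "vdegree E w = 3" using thick_low_degree[OF in_cycle_thick[OF assms(2)] assms(5)] assms(4) by blast
  then obtain b where b: "\<not> center w" "center b" "rest T w b" using assms(3) by (auto simp: removable_def)
  obtain t v z where tv: "t \<in> T" "tri b t w" "tri b t v" "w \<noteq> v" "out w z" "z \<notin> T" "rest T b v"
    using removable_diamond[OF assms(1,2) b] by metis
  have "s = t" using thick_unique[OF in_cycle_thick[OF assms(2)] assms(5) _ assms(4) tv(1)] tri_adj[OF tv(2)] by blast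
  then have "u = b \<or> u = w \<or> u = v" using center_diamond(2)[OF tv(2-4)] assms(6) by blast
  then show ?thesis using b(3) tv(7) by (meson r_into_rtranclp rtranclp.rtrancl_into_rtrancl rtranclp.rtrancl_refl)
qed

text \<open>In a walk of length 3, at most one of the two middle vertices is in the independent
  \<open>T\<close>, and it is adjacent to an end, so \<open>removable_closed\<close> applies from
  that end.\<close>

lemma removable_near:
  assumes "valid T" "in_cycle T w" "removable T w" "in_cycle T w'" "removable T w'" "near w w'"
  shows "(rest T)\<^sup>*\<^sup>* w w'"
proof -
  note cl = removable_closed[OF assms(1-3)]
  have cl': "(rest T)\<^sup>*\<^sup>* u w'" if "s \<in> T" "adj s w'" "adj u s" for s u
    using rest_rtranclp_sym[OF removable_closed[OF assms(1,4,5) that(1)]] that adj_sym by blast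
  have wT: "w \<notin> T" "w' \<notin> T" using in_cycle_thick[OF assms(2)] in_cycle_thick[OF assms(4)] by (simp_all add: thick_def)
  have r: "(rest T)\<^sup>*\<^sup>* x y" if "adj x y" "x \<notin> T" "y \<notin> T" for x y using that by (auto simp: rest_def)
  consider "w = w'" | "adj w w'" | a where "adj w a" "adj a w'" | a b where "adj w a" "adj a b" "adj b w'"
    using assms(6) unfolding near_def by blast
  then show ?thesis
  proof cases
    case 3
    then show ?thesis using cl r wT by (meson rtranclp_trans)
  next
    case 4
    show ?thesis
    proof (cases "a \<in> T")
      case True
      then have "b \<notin> T" using valid_indep[OF assms(1)] 4 by blast
      then show ?thesis using cl[OF True 4(1,2)] r[OF 4(3)] wT(2) by (meson rtranclp_trans)
    next
      case False
      then show ?thesis using r[OF 4(1) wT(1) False] r[OF 4(2) False] r[OF 4(3) _ wT(2)] cl'[OF _ 4(3,2)]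
        by (meson rtranclp_trans)
    qed
  qed (use r wT in auto)
qed

definition paired :: "'a set \<Rightarrow> 'a set" where
  "paired T = {x \<in> V - T. in_cycle T x \<and> (\<forall>y. (rest T)\<^sup>*\<^sup>* x y \<longrightarrow> vdegree E y = 3 \<and> \<not> center y)}"

lemma paired_rest:
  assumes "x \<in> paired T" "rest T x y" shows "y \<in> paired T"
proof -
  have "y \<in> V" "y \<notin> T" using assms(2) adj_V(2) by (auto simp: rest_def)
  moreover have "in_cycle T y" using assms in_cycle_rest by (auto simp: paired_def)
  ultimately show ?thesis using assms by (auto simp: paired_def intro: converse_rtranclp_into_rtranclp)
qed

text \<open>Each vertex \<open>v\<close> is on a single triangle, of which \<open>T\<close> takes
  exactly one vertex. This leaves one partner \<open>p v\<close> there, and the other edge of the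
  cycle at \<open>v\<close> is the outgoing one, to \<open>m v\<close>.\<close>

lemma paired_bipartite:
  assumes "valid T"
  shows "\<exists>f::'a \<Rightarrow> bool. \<forall>v\<in>paired T. \<forall>u. rest T v u \<longrightarrow> f u \<noteq> f v"
proof -
  let ?p = "\<lambda>v q. \<exists>t\<in>T. tri v t q"
  define p where "p v = (SOME q. ?p v q)" for v
  define m where "m v = (SOME z. out v z)" for v
  have P: "\<exists>q z. ?p v q \<and> q \<in> paired T \<and> out v z \<and> z \<in> paired T \<and> (\<forall>q'. ?p v q' \<longrightarrow> q' = q) \<and>
      (\<forall>z'. out v z' \<longrightarrow> z' = z) \<and> (\<forall>u. rest T v u \<longrightarrow> u = q \<or> u = z)" if v: "v \<in> paired T" for v
  proof -
    have v': "v \<notin> T" "in_cycle T v" "vdegree E v = 3" "\<not> center v" using v by (auto simp: paired_def)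
    obtain x y where xy: "tri v x y" using degree3_tri v'(3) by blast
    then have "x \<in> T \<or> y \<in> T" using valid_hit[OF assms] v'(1) by blast
    then obtain t q where q: "t \<in> T" "tri v t q" using xy tri_sym(2) by blast
    have qT: "q \<notin> T" using valid_indep[OF assms q(1)] tri_adj[OF q(2)] by blast
    have qq: "q' = q" if "?p v q'" for q'
      using that not_center_tri_unique[OF v'(4) q(2)] qT q(1) by (metis doubleton_eq_iff)
    obtain z where z: "rest T v z" "z \<noteq> q" using thickE[OF in_cycle_thick[OF v'(2)]] by metis
    then have o: "out v z" using not_center_nbr[OF v'(4) q(2), of z] q(1) unfolding rest_def by blast
    have rq: "rest T v q" using tri_adj(5)[OF q(2)] v'(1) qT by (simp add: rest_def)
    have "u = q \<or> u = z" if "rest T v u" for u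
      using tri_out_nbrs(1)[OF q(2) o, of u] that q(1) unfolding rest_def by blast
    then show ?thesis
      using q qq o out_unique[OF q(2) o] paired_rest[OF v rq] paired_rest[OF v z(1)] by blast
  qed
  have p: "?p v (p v)" "?p v q \<Longrightarrow> q = p v" "p v \<in> paired T" if v: "v \<in> paired T" for v q
  proof -
    obtain q0 where q0: "?p v q0" "q0 \<in> paired T" "\<forall>q'. ?p v q' \<longrightarrow> q' = q0" using P[OF v] by blast
    have "?p v (p v)" unfolding p_def using q0(1) by (rule someI)
    then show "?p v (p v)" "?p v q \<Longrightarrow> q = p v" "p v \<in> paired T" using q0 by metis+
  qed
  have m: "out v (m v)" "out v z \<Longrightarrow> z = m v" "m v \<in> paired T" if v: "v \<in> paired T" for v z
  proof -
    obtain z0 where z0: "out v z0" "z0 \<in> paired T" "\<forall>z. out v z \<longrightarrow> z = z0" using P[OF v] by blast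
    have "out v (m v)" unfolding m_def using z0(1) by (rule someI)
    then show "out v (m v)" "out v z \<Longrightarrow> z = m v" "m v \<in> paired T" using z0 by metis+
  qed
  have "\<exists>f::'a \<Rightarrow> bool. \<forall>v\<in>paired T. f (m v) \<noteq> f v \<and> f (p v) \<noteq> f v"
  proof (rule two_matchings_bipartite)
    show "finite (paired T)" by (rule finite_subset[OF _ finite_V]) (auto simp: paired_def)
    show "m v \<in> paired T \<and> m v \<noteq> v \<and> m (m v) = v" if v: "v \<in> paired T" for v
      using m(3)[OF v] m(2)[OF m(3)[OF v] out_sym[OF m(1)[OF v]]] out_adj(1)[OF m(1)[OF v]] adj_irrefl by metis
    show "p v \<in> paired T \<and> p v \<noteq> v \<and> p (p v) = v" if v: "v \<in> paired T" for v
    proof -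
      obtain t where t: "t \<in> T" "tri v t (p v)" using p(1)[OF v] by blast
      then have "?p (p v) v" using tri_sym(3) by blast
      then have "p (p v) = v" using p(2)[OF p(3)[OF v]] by metis
      then show ?thesis using p(3)[OF v] tri_adj(9)[OF t(2)] by simp
    qed
  qed
  then obtain f :: "'a \<Rightarrow> bool" where f: "\<forall>v\<in>paired T. f (m v) \<noteq> f v \<and> f (p v) \<noteq> f v" by blast
  have "f u \<noteq> f v" if v: "v \<in> paired T" "rest T v u" for u v
  proof -
    have "u = p v \<or> u = m v" using P[OF v(1)] v(2) p(1)[OF v(1)] m(1)[OF v(1)] by metis
    then show ?thesis using f v(1) by blast
  qed
  then show ?thesis by blast
qed

section \<open>Opening the remaining cycles\<close>

lemma removable_exists:
  assumes "valid T" "in_cycle T x" "vdegree E x \<noteq> 3 \<or> center x"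
  shows "\<exists>w. (rest T)\<^sup>*\<^sup>* x w \<and> removable T w"
proof (cases "center x")
  case True
  have xT: "x \<notin> T" using in_cycle_thick[OF assms(2)] by (simp add: thick_def)
  obtain t y z where D: "t \<in> T" "tri x t y" "tri x t z" "y \<noteq> z" using center_mem[OF assms(1) True xT] .
  have "y \<notin> T" using valid_indep[OF assms(1) D(1)] tri_adj[OF D(2)] by blast
  then have "rest T x y" using xT tri_adj[OF D(2)] by (simp add: rest_def)
  moreover have "removable T y"
    using center_diamond(5)[OF D(2-4)] True rest_sym[OF \<open>rest T x y\<close>] unfolding removable_def by blast
  ultimately show ?thesis by blast
next
  case False
  then show ?thesis using assms(3) unfolding removable_def by blast
qed

lemma bipartite_after_removal:
  assumes "valid T"
  obtains W and f :: "'a \<Rightarrow> nat" where "W \<subseteq> V - T"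
    "\<And>w. w \<in> W \<Longrightarrow> card (conflicts T w) \<le> 2"
    "\<And>w w'. w \<in> W \<Longrightarrow> w' \<in> W \<Longrightarrow> w \<noteq> w' \<Longrightarrow> \<not> near w w'"
    "\<And>v. v \<in> V - T - W \<Longrightarrow> f v \<le> 1"
    "\<And>v u. v \<in> V - T - W \<Longrightarrow> u \<in> V - T - W \<Longrightarrow> adj v u \<Longrightarrow> f v \<noteq> f u"
proof -
  define comp where "comp x = {y. (rest T)\<^sup>*\<^sup>* x y}" for x
  \<comment> \<open>The choice depends on the component as a set, so all vertices of a cycle share
    it and \<open>W\<close> meets each cycle at most once.\<close>
  define pick where "pick C = (SOME w. w \<in> C \<and> removable T w)" for C
  define bad where "bad = {x \<in> V - T. in_cycle T x \<and> (\<exists>w\<in>comp x. removable T w)}"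
  define W where "W = (\<lambda>x. pick (comp x)) ` bad"
  have comp_eq: "comp x = comp y" if "(rest T)\<^sup>*\<^sup>* x y" for x y
    unfolding comp_def using that rest_rtranclp_sym[OF that] by (auto intro: rtranclp_trans)
  have comp_V: "y \<in> V - T" if "(rest T)\<^sup>*\<^sup>* x y" "x \<in> V - T" for x y
    using that by (induction rule: rtranclp_induct) (auto simp: rest_def dest: adj_V)
  have pick: "(rest T)\<^sup>*\<^sup>* x (pick (comp x))" "removable T (pick (comp x))" if "x \<in> bad" for x
    using someI_ex[of "\<lambda>w. w \<in> comp x \<and> removable T w"] that unfolding pick_def bad_def comp_def by blast+
  have Wp: "in_cycle T w \<and> removable T w \<and> w \<in> V - T \<and> w = pick (comp w)" if w: "w \<in> W" for w
  proof -
    obtain x where x: "x \<in> bad" "w = pick (comp x)" using w unfolding W_def by blast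
    have "in_cycle T x" "x \<in> V - T" using x(1) by (auto simp: bad_def)
    then show ?thesis using pick[OF x(1)] x(2) in_cycle_rtranclp comp_V comp_eq by metis
  qed
  obtain g :: "'a \<Rightarrow> bool" where g: "\<forall>v\<in>paired T. \<forall>u. rest T v u \<longrightarrow> g u \<noteq> g v"
    using paired_bipartite[OF assms] by blast
  let ?A = "V - T - W - paired T"
  \<comment> \<open>What is left is a forest, hence 1-degenerate, and two colours suffice.\<close>
  have "\<exists>h::'a \<Rightarrow> nat. \<forall>x\<in>?A. h x \<le> 1 \<and> (\<forall>y\<in>?A. x \<noteq> y \<longrightarrow> rest T x y \<longrightarrow> h x \<noteq> h y)"
  proof (rule degenerate_colorable)
    show "finite ?A" using finite_V by simp
    show "rest T y x" if "rest T x y" for x y using rest_sym[OF that] .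
    show "\<exists>s\<in>S. card {x \<in> S. x \<noteq> s \<and> rest T s x} \<le> 1" if S: "S \<subseteq> ?A" "S \<noteq> {}" for S
    proof (rule ccontr)
      assume "\<not> ?thesis"
      \<comment> \<open>Such an \<open>S\<close> would contain all neighbours of its vertices
        outside \<open>T\<close>, so it would be a union of whole cycles. As these are not in
        \<open>paired T\<close>, they contain removable vertices and thus an element of
        \<open>W\<close>.\<close>
      then have two: "2 \<le> card {x \<in> S. x \<noteq> s \<and> rest T s x}" if "s \<in> S" for s using that by fastforce
      have sub: "{x \<in> S. x \<noteq> s \<and> rest T s x} \<subseteq> {u. rest T s u}" for s by blast
      have eq: "{x \<in> S. x \<noteq> s \<and> rest T s x} = {u. rest T s u}" if "s \<in> S" for s
      proof (rule card_seteq[OF finite_rest sub])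
        show "card {u. rest T s u} \<le> card {x \<in> S. x \<noteq> s \<and> rest T s x}"
          using two[OF that] card_rest_le[OF assms, of s] that S(1) by force
      qed
      have closed: "y \<in> S" if "(rest T)\<^sup>*\<^sup>* x y" "x \<in> S" for x y
        using that by (induction rule: rtranclp_induct) (use eq in blast)+
      have th: "thick T s" if "s \<in> S" for s
        using two[OF that] eq[OF that] that S(1) by (auto simp: thick_def)
      obtain x where x: "x \<in> S" using S(2) by blast
      have rx: "in_cycle T x" unfolding in_cycle_def using closed x th by blast
      obtain y where y: "(rest T)\<^sup>*\<^sup>* x y" "vdegree E y \<noteq> 3 \<or> center y"
        using x S(1) rx unfolding paired_def by blast
      obtain w where "(rest T)\<^sup>*\<^sup>* y w" "removable T w"
        using removable_exists[OF assms in_cycle_rtranclp[OF rx y(1)] y(2)] by blast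
      then have "x \<in> bad" using x S(1) rx y(1) unfolding bad_def comp_def by (auto intro: rtranclp_trans)
      then have "pick (comp x) \<in> W" "pick (comp x) \<in> S"
        using pick(1) closed x unfolding W_def by blast+
      then show False using S(1) by blast
    qed
  qed
  then obtain h :: "'a \<Rightarrow> nat" where
    h: "\<forall>x\<in>?A. h x \<le> 1 \<and> (\<forall>y\<in>?A. x \<noteq> y \<longrightarrow> rest T x y \<longrightarrow> h x \<noteq> h y)" by blast
  define f where "f v = (if v \<in> paired T then of_bool (g v) else h v)" for v
  show ?thesis
  proof (rule that)
    show "W \<subseteq> V - T" using Wp by blast
    show "card (conflicts T w) \<le> 2" if "w \<in> W" for w using removable_card[OF assms] Wp[OF that] by blast
    show "\<not> near w w'" if "w \<in> W" "w' \<in> W" "w \<noteq> w'" for w w'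
      using removable_near[OF assms] Wp[OF that(1)] Wp[OF that(2)] that(3) comp_eq by metis
    show "f v \<le> 1" if "v \<in> V - T - W" for v using that h by (auto simp: f_def)
    show "f v \<noteq> f u" if uv: "v \<in> V - T - W" "u \<in> V - T - W" "adj v u" for u v
    proof -
      have r: "rest T v u" "v \<noteq> u" using uv adj_irrefl by (auto simp: rest_def)
      show ?thesis
      proof (cases "v \<in> paired T")
        case True
        then show ?thesis using paired_rest[OF True r(1)] g r(1) by (auto simp: f_def)
      next
        case False
        then have "u \<notin> paired T" using paired_rest rest_sym[OF r(1)] by blast
        then show ?thesis using False uv r h by (auto simp: f_def)
      qed
    qed
  qed
qed

section \<open>Assembling the five classes\<close>

lemma coloring_exists:
  "\<exists>col::'a \<Rightarrow> nat. (\<forall>v\<in>V. col v < 5) \<and>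
     (\<forall>u\<in>V. \<forall>v\<in>V. u \<noteq> v \<longrightarrow> col u = col v \<longrightarrow> \<not> adj u v \<and> (2 \<le> col u \<longrightarrow> \<not> near u v))"
proof -
  obtain T where T: "optimal T" using optimal_exists by blast
  then have val: "valid T" by (simp add: optimal_def)
  obtain c :: "'a \<Rightarrow> nat" where
    c: "\<forall>x\<in>T. c x \<le> 2 \<and> (\<forall>y\<in>T. x \<noteq> y \<longrightarrow> near x y \<longrightarrow> c x \<noteq> c y)"
    using optimal_colorable[OF T] by blast
  obtain W and f :: "'a \<Rightarrow> nat" where W: "W \<subseteq> V - T"
    "\<And>w. w \<in> W \<Longrightarrow> card (conflicts T w) \<le> 2"
    "\<And>w w'. w \<in> W \<Longrightarrow> w' \<in> W \<Longrightarrow> w \<noteq> w' \<Longrightarrow> \<not> near w w'"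
    and f: "\<And>v. v \<in> V - T - W \<Longrightarrow> f v \<le> 1"
    "\<And>v u. v \<in> V - T - W \<Longrightarrow> u \<in> V - T - W \<Longrightarrow> adj v u \<Longrightarrow> f v \<noteq> f u"
    using bipartite_after_removal[OF val] by blast
  have "\<exists>i\<le>2. i \<notin> c ` conflicts T w" if "w \<in> W" for w
  proof (rule ccontr)
    assume "\<not> ?thesis"
    then have "{..2} \<subseteq> c ` conflicts T w" by auto
    moreover have fin: "finite (conflicts T w)" using valid_finite[OF val] by (simp add: conflicts_def)
    ultimately have "3 \<le> card (c ` conflicts T w)" using card_mono[of "c ` conflicts T w" "{..2}"] by simp
    then show False using card_image_le[OF fin, of c] W(2)[OF that] by linarith
  qed
  then obtain d where d: "\<And>w. w \<in> W \<Longrightarrow> d w \<le> 2 \<and> d w \<notin> c ` conflicts T w" by metis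
  \<comment> \<open>Colours 2, 3 and 4 are the classes for distance 3, shared by \<open>T\<close>
    and \<open>W\<close>; 0 and 1 form the bipartition of the rest.\<close>
  define col where "col v = (if v \<in> T then c v + 2 else if v \<in> W then d v + 2 else f v)" for v
  have sep: "col u \<noteq> col v" if uv: "u \<in> T \<union> W" "v \<in> T \<union> W" "u \<noteq> v" "near u v" for u v
  proof -
    have "c t \<noteq> d w" if "t \<in> T" "w \<in> W" "near w t" for t w
    proof -
      have "t \<in> conflicts T w" using that W(1) by (auto simp: conflicts_def)
      then show ?thesis using d[OF that(2)] by (metis imageI)
    qed
    then have cd: "col t \<noteq> col w" if "t \<in> T" "w \<in> W" "near w t" for t w
      using that W(1) by (auto simp: col_def)
    consider "u \<in> T" "v \<in> T" | "u \<in> T" "v \<in> W" | "u \<in> W" "v \<in> T" | "u \<in> W" "v \<in> W"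
      using uv(1,2) by blast
    then show ?thesis
    proof cases
      case 1
      then show ?thesis using c uv(3,4) by (auto simp: col_def)
    next
      case 2
      then show ?thesis using cd near_sym[OF uv(4)] by blast
    next
      case 3
      then show ?thesis using cd[OF 3(2,1) uv(4)] by simp
    next
      case 4
      then show ?thesis using W(3) uv(3,4) by blast
    qed
  qed
  have adj_near: "near u v" if "adj u v" for u v using that unfolding near_def by blast
  have low: "col v \<le> 1" if "v \<in> V - (T \<union> W)" for v using that f(1)[of v] by (auto simp: col_def)
  have high: "2 \<le> col v" if "v \<in> T \<union> W" for v using that by (auto simp: col_def)
  have lt: "col v < 5" if vV: "v \<in> V" for v
  proof -
    consider "v \<in> T" | "v \<in> W" "v \<notin> T" | "v \<in> V - T - W" using vV by blast
    then show ?thesis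
    proof cases
      case 1
      then have "c v \<le> 2" using c by blast
      then show ?thesis using 1 by (simp add: col_def)
    next
      case 2
      then show ?thesis using d[of v] by (simp add: col_def)
    next
      case 3
      then show ?thesis using f(1)[of v] by (simp add: col_def)
    qed
  qed
  have "\<not> adj u v \<and> (2 \<le> col u \<longrightarrow> \<not> near u v)" if uv: "u \<in> V" "v \<in> V" "u \<noteq> v" "col u = col v" for u v
  proof (cases "u \<in> T \<union> W")
    case True
    then have "v \<in> T \<union> W" using high[OF True] low[of v] uv by force
    then show ?thesis using sep[OF True _ uv(3)] uv(4) adj_near by blast
  next
    case False
    then have "v \<notin> T \<union> W" using high[of v] low[of u] uv by force
    then show ?thesis using False f(2)[of u v] low[of u] uv by (auto simp: col_def)
  qed
  then show ?thesis using lt by blast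
qed

section \<open>From distances to walks\<close>

lemma gdist_le_walk:
  assumes "\<not> gdist V E u v > enat n"
  obtains p where "walk_in V E p" "hd p = u" "last p = v" "length p \<le> Suc n"
proof -
  \<comment> \<open>A strict bound on the infimum produces an actual walk.\<close>
  have "gdist V E u v < enat (Suc n)"
    using assms by (metis enat_ord_simps(2) lessI not_less order_le_less_trans)
  then obtain p where p: "walk_in V E p" "hd p = u" "last p = v" "length p - 1 < Suc n"
    unfolding gdist_def INF_less_iff by auto
  then show ?thesis using that[of p] by simp
qed

text \<open>The bounds 2 and 4 count vertices, one more than the distances 1 and 3.\<close>

lemma walk_cases:
  assumes "walk_in V E p" "hd p = u" "last p = v"
  shows "length p \<le> 2 \<Longrightarrow> u = v \<or> adj u v" "length p \<le> 4 \<Longrightarrow> near u v"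
proof -
  have w: "p \<noteq> []" "successively adj p" using assms(1) unfolding walk_in_def adj_def by auto
  obtain a q where a: "p = a # q" using w(1) by (cases p) auto
  show "u = v \<or> adj u v" if "length p \<le> 2"
    using that w a assms(2,3) by (cases q) auto
  show "near u v" if "length p \<le> 4"
  proof (cases q)
    case Nil
    then show ?thesis using a assms by (simp add: near_def)
  next
    case b: (Cons b r)
    show ?thesis
    proof (cases r)
      case Nil
      then show ?thesis using a b w assms by (auto simp: near_def)
    next
      case c: (Cons c s)
      show ?thesis
      proof (cases s)
        case Nil
        then show ?thesis using a b c w assms by (auto simp: near_def)
      next
        case (Cons d e)
        then have "p = [a, b, c, d]" using that a b c by simp
        then show ?thesis using w assms by (auto simp: near_def)
      qed
    qed
  qed
qed

lemma packing_colorable_11333: "packing_colorable V E [1, 1, 3, 3, 3]"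
proof -
  obtain col :: "'a \<Rightarrow> nat" where col: "\<And>v. v \<in> V \<Longrightarrow> col v < 5"
    "\<And>u v. u \<in> V \<Longrightarrow> v \<in> V \<Longrightarrow> u \<noteq> v \<Longrightarrow> col u = col v \<Longrightarrow> \<not> adj u v \<and> (2 \<le> col u \<longrightarrow> \<not> near u v)"
    using coloring_exists by blast
  define P where "P i = {v \<in> V. col v = i}" for i
  have "gdist V E u v > enat ([1, 1, 3, 3, 3] ! i)" if i: "i < 5" "u \<in> P i" "v \<in> P i" "u \<noteq> v" for i u v
  proof (rule ccontr)
    assume "\<not> ?thesis"
    then obtain p where p: "walk_in V E p" "hd p = u" "last p = v" "length p \<le> Suc ([1, 1, 3, 3, 3] ! i)"
      by (rule gdist_le_walk)
    have uv: "\<not> adj u v" "2 \<le> i \<longrightarrow> \<not> near u v" using col(2)[of u v] i by (auto simp: P_def)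
    have "i = 0 \<or> i = 1 \<or> i = 2 \<or> i = 3 \<or> i = 4" using i(1) by auto
    then show False using walk_cases[OF p(1-3)] p(4) uv i(4) by auto
  qed
  then have "packing_coloring V E [1, 1, 3, 3, 3] P"
    unfolding packing_coloring_def disjoint_family_on_def using col(1) by (auto simp: P_def eval_nat_numeral)
  then show ?thesis unfolding packing_colorable_def by blast
qed

end

theorem theorem7:
  fixes V :: "'a set" and E :: "'a set set"
  assumes "simple_graph V E"
    and "subcubic V E"
    and "saturated3 V E 2"
    and "girth3 V E = 3"
  shows "packing_colorable V E [1, 1, 3, 3, 3]"
proof -
  have "\<exists>x y. {v, x} \<in> E \<and> {x, y} \<in> E \<and> {v, y} \<in> E" if v: "v \<in> V" "vdegree E v = 3" for v
  proof -
    have "local_girth V E v \<le> girth3 V E" unfolding girth3_def using v by (intro SUP_upper) simp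
    \<comment> \<open>Below 4 rather than at most 3, so that the infimum yields a cycle; having at
      least three vertices, it is a triangle.\<close>
    then have "local_girth V E v < enat 4" using assms(4) by (auto simp: numeral_eq_enat elim: order_le_less_trans)
    then obtain c where c: "cycle_in V E c" "v \<in> set c" "length c < 4"
      unfolding local_girth_def INF_less_iff by auto
    then have "length c = 3" by (simp add: cycle_in_def)
    then obtain x y z where "c = [x, y, z]" by (auto simp: numeral_3_eq_3 length_Suc_conv)
    then have "{x, y} \<in> E" "{y, z} \<in> E" "{z, x} \<in> E" "v = x \<or> v = y \<or> v = z"
      using c(1,2) by (auto simp: cycle_in_def walk_in_def)
    then show ?thesis by (metis insert_commute)
  qed
  then interpret triangle_subcubic V E using assms by unfold_locales
  show ?thesis by (rule packing_colorable_11333)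
qed
end
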